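(* Fix $\zeta>0$ and consider the sub-Gaussian all-subset setting of the context (with $\alpha=2$, $\eta_n=\log n$, $C_S=s\log p$). There is a constant $\lambda_{\mathrm{sel}}$ depending only on $\zeta$ such that for every $\lambda\ge\lambda_{\mathrm{sel}}$, under Scenarios 1–3 there exists a constant $c_\lambda>0$ such that the DCIC minimizer is selection consistent, i.e. $$\Pr\Bigl(\min_{S\subseteq[p],\,S\ne S^*}\mathrm{DCIC}(S)>\mathrm{DCIC}(S^* )\Bigr)\to1\quad(n\to\infty),$$ under the following conditions, respectively: (i) in Scenario 1, $\displaystyle\beta_{\min}^2\ge c_\lambda\sigma^2\frac{\log p+\log n}{(1-\omega)n}$; (ii) in Scenario 2, $\displaystyle\beta_{\min}^2\ge c_\lambda\sigma^2\frac{\log p+\log n}{\epsilon_0\lambda_*n}$; (iii) in Scenario 3, $\displaystyle\beta_{\min}^2\ge c_\lambda\sigma^2\frac{\log p+\log n}{(1-\omega^2)n}$.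
   Context: Model: $X\in\mathbb R^{n\times p}$ is a fixed design, $y=X\beta^*+\varepsilon$, $\beta^*\in\mathbb R^p$ has support $S^*$, $s^*=|S^*|$, $\beta_{\min}=\min_{j\in S^*}|\beta^*_j|$. The errors $\varepsilon_i$ are independent, mean zero, $\mathbb E(\varepsilon_i^2)=\sigma^2$, with $\Pr(|\varepsilon_i/\sigma|>t)\le2\exp\{-(t/\zeta)^2\}$ for all $t\ge2$. All subsets $S\subseteq[p]=\{1,\dots,p\}$ are candidates. With $s=|S|$, $X_S$ the submatrix of columns in $S$, $P_S$ the orthogonal projection onto $\mathrm{Col}(X_S)$, and $\mathrm{RSS}(S)=\|(\mathrm I_n-P_S)y\|_2^2$, $$\mathrm{DCIC}(S)=\mathrm{RSS}(S)/\sigma^2+s\log n+\lambda s\log p .$$ The sample Gram matrix is $\widehat\Sigma=X^\top X/n$. Scenario 1 (equicorrelation): the predictors are centered and standardized and $\widehat\Sigma=(1-\omega)\mathrm I_p+\omega\mathbf 1_p\mathbf 1_p^\top$ for some $\omega\in[0,1)$, with $\mathbf 1_p$ the $p$-dimensional all-ones vector. Scenario 2 (weak alignment with spurious predictors): $\lambda_{\min}(\widehat\Sigma_{S^*S^*})\ge\lambda_*>0$, and there exist constants $\kappa_0\ge1$ and $\epsilon_0\in(0,1)$ such that $$\sup_{|S|\le(1+\kappa_0)s^*,\ S^*\setminus S\ne\emptyset}\frac{\|P_SX_{S^*\setminus S}\beta^*_{S^*\setminus S}\|_2^2}{\|X_{S^*\setminus S}\beta^*_{S^*\setminus S}\|_2^2}\le1-\epsilon_0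 .$$ Scenario 3 (shadow predictors): $\widehat\Sigma_{S^*S^*}=\mathrm I_{s^*}$. For each $j\in S^*$ there exists a shadow predictor $\tilde j\in(S^* )^c$ such that $\widehat\Sigma_{j,\tilde j}=\omega$ for some $\omega\in(0,1)$. Let $\widetilde S=\{\tilde j:j\in S^*\}$, with $|\widetilde S|=s^*$. These $s^*$ signal–shadow pairs are mutually uncorrelated and are also uncorrelated with all remaining predictors (i.e. the corresponding entries of $\widehat\Sigma$ are $0$).
   Formalization: In Scenario 3 the shadow predictors are additionally assumed to have unit sample variance, so that ω is the correlation of each pair; without this the claim fails, e.g. for the shadow column ωX_j, which gives a competing model with the same DCIC. *)

theory Defs
  imports
    "HOL-Probability.Probability"
    "Jordan_Normal_Form.Spectral_Radius"
    "Jordan_Normal_Form.DL_Submatrix"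
begin

no_notation vec_nth (infixl \<open>$\<close> 90)
no_notation inner (infix \<open>\<bullet>\<close> 70)

text \<open>
  A design is an n-by-p real matrix. Predictors are indexed from 0, so the index set
  \<^term>\<open>{..<p}\<close> plays the role of [p], and candidate models are subsets of it.
\<close>

definition sqnorm :: "real vec \<Rightarrow> real" where
  "sqnorm v = v \<bullet> v"

definition cols_at :: "real mat \<Rightarrow> nat set \<Rightarrow> real mat" where
  "cols_at X S = submatrix X UNIV S"

text \<open>The entries are ordered by increasing index, as the columns of \<^const>\<open>cols_at\<close> are.\<close>
definition subvec :: "real vec \<Rightarrow> nat set \<Rightarrow> real vec" where
  "subvec v S = vec (card {j. j < dim_vec v \<and> j \<in> S}) (\<lambda>i. v $ pick S i)"

definition gram :: "real mat \<Rightarrow> real mat" where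
  "gram X = (1 / real (dim_row X)) \<cdot>\<^sub>m (X\<^sup>T * X)"

definition orth_proj :: "real vec set \<Rightarrow> real vec \<Rightarrow> real vec" where
  "orth_proj W v = (THE w. w \<in> W \<and> (\<forall>u\<in>W. (v - w) \<bullet> u = 0))"

definition proj_cols :: "real mat \<Rightarrow> nat set \<Rightarrow> real vec \<Rightarrow> real vec" where
  "proj_cols X S = orth_proj (vec_space.col_space (dim_row X) (cols_at X S))"

definition RSS :: "real mat \<Rightarrow> real vec \<Rightarrow> nat set \<Rightarrow> real" where
  "RSS X y S = sqnorm (y - proj_cols X S y)"

definition DCIC :: "real \<Rightarrow> real \<Rightarrow> real mat \<Rightarrow> real vec \<Rightarrow> nat set \<Rightarrow> real" where
  "DCIC lam \<sigma> X y S =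
     RSS X y S / \<sigma>\<^sup>2 + real (card S) * ln (real (dim_row X))
       + lam * real (card S) * ln (real (dim_col X))"

definition supp_vec :: "real vec \<Rightarrow> nat set" where
  "supp_vec \<beta> = {j. j < dim_vec \<beta> \<and> \<beta> $ j \<noteq> 0}"

text \<open>
  Meaningful for nonzero \<open>\<beta>\<close> only; for \<open>\<beta> = 0\<close> the minimum is an unspecified real.
\<close>
definition beta_min :: "real vec \<Rightarrow> real" where
  "beta_min \<beta> = Min ((\<lambda>j. \<bar>\<beta> $ j\<bar>) ` supp_vec \<beta>)"

definition lambda_min :: "real mat \<Rightarrow> real" where
  "lambda_min A = Min (spectrum A)"

locale subgaussian_linear_model = prob_space M for M :: "'a measure" +
  fixes n p :: nat
    and X :: "real mat"
    and \<beta> :: "real vec"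
    and \<sigma> \<zeta> :: real
    and \<epsilon> :: "nat \<Rightarrow> 'a \<Rightarrow> real"
  assumes p_pos: "1 \<le> p"
    and X_dim: "X \<in> carrier_mat n p"
    and beta_dim: "\<beta> \<in> carrier_vec p"
    and sigma_pos: "0 < \<sigma>"
    and errors_indep: "indep_vars (\<lambda>_. borel) \<epsilon> {..<n}"
    and errors_integrable: "\<And>i. i < n \<Longrightarrow> integrable M (\<epsilon> i)"
    and errors_mean: "\<And>i. i < n \<Longrightarrow> expectation (\<epsilon> i) = 0"
    and errors_sq_integrable: "\<And>i. i < n \<Longrightarrow> integrable M (\<lambda>x. (\<epsilon> i x)\<^sup>2)"
    and errors_variance: "\<And>i. i < n \<Longrightarrow> expectation (\<lambda>x. (\<epsilon> i x)\<^sup>2) = \<sigma>\<^sup>2"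
    and errors_tail: "\<And>i t. i < n \<Longrightarrow> 2 \<le> t \<Longrightarrow>
          prob {x \<in> space M. \<bar>\<epsilon> i x / \<sigma>\<bar> > t} \<le> 2 * exp (- ((t / \<zeta>)\<^sup>2))"

definition response ::
    "real mat \<Rightarrow> real vec \<Rightarrow> (nat \<Rightarrow> 'a \<Rightarrow> real) \<Rightarrow> 'a \<Rightarrow> real vec" where
  "response X \<beta> \<epsilon> x = X *\<^sub>v \<beta> + vec (dim_row X) (\<lambda>i. \<epsilon> i x)"

definition selection_prob ::
    "'a measure \<Rightarrow> real mat \<Rightarrow> real vec \<Rightarrow> real \<Rightarrow> (nat \<Rightarrow> 'a \<Rightarrow> real) \<Rightarrow> real \<Rightarrow> real" where
  "selection_prob M X \<beta> \<sigma> \<epsilon> lam =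
     measure M {x \<in> space M.
       Min (DCIC lam \<sigma> X (response X \<beta> \<epsilon> x) ` {S. S \<subseteq> {..<dim_col X} \<and> S \<noteq> supp_vec \<beta>})
         > DCIC lam \<sigma> X (response X \<beta> \<epsilon> x) (supp_vec \<beta>)}"

definition centered :: "real mat \<Rightarrow> bool" where
  "centered X \<longleftrightarrow> (\<forall>j<dim_col X. (\<Sum>i<dim_row X. X $$ (i, j)) = 0)"

definition standardized :: "real mat \<Rightarrow> bool" where
  "standardized X \<longleftrightarrow> (\<forall>j<dim_col X. sqnorm (col X j) = real (dim_row X))"

definition scenario1 :: "real mat \<Rightarrow> real \<Rightarrow> bool" where
  "scenario1 X \<omega> \<longleftrightarrow>
     0 \<le> \<omega> \<and> \<omega> < 1 \<and> centered X \<and> standardized X \<and>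
     gram X = (1 - \<omega>) \<cdot>\<^sub>m 1\<^sub>m (dim_col X)
                + \<omega> \<cdot>\<^sub>m mat (dim_col X) (dim_col X) (\<lambda>(i, j). 1)"

definition scenario2 ::
    "real mat \<Rightarrow> real vec \<Rightarrow> real \<Rightarrow> real \<Rightarrow> real \<Rightarrow> bool" where
  "scenario2 X \<beta> lam_star \<kappa>0 \<epsilon>0 \<longleftrightarrow>
     0 < lam_star \<and> lam_star \<le> lambda_min (submatrix (gram X) (supp_vec \<beta>) (supp_vec \<beta>)) \<and>
     (SUP S \<in> {S. S \<subseteq> {..<dim_col X} \<and>
                 real (card S) \<le> (1 + \<kappa>0) * real (card (supp_vec \<beta>)) \<and>
                 supp_vec \<beta> - S \<noteq> {}}.
        (let N = supp_vec \<beta> - S; v = cols_at X N *\<^sub>v subvec \<beta> N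
         in sqnorm (proj_cols X S v) / sqnorm v)) \<le> 1 - \<epsilon>0"

text \<open>
  The map \<open>sh\<close> sends a signal to its shadow. The shadows have unit sample variance, so that
  \<open>\<omega>\<close> is the correlation of each signal-shadow pair; nothing is assumed about the variances
  of the remaining predictors.
\<close>
definition scenario3 :: "real mat \<Rightarrow> nat set \<Rightarrow> real \<Rightarrow> bool" where
  "scenario3 X S \<omega> \<longleftrightarrow>
     0 < \<omega> \<and> \<omega> < 1 \<and> submatrix (gram X) S S = 1\<^sub>m (card S) \<and>
     (\<exists>sh. inj_on sh S \<and> sh ` S \<subseteq> {..<dim_col X} - S \<and>
        (\<forall>j\<in>S. gram X $$ (sh j, sh j) = 1 \<and> gram X $$ (j, sh j) = \<omega>) \<and>
        (\<forall>j\<in>S. \<forall>k\<in>S. j \<noteq> k \<longrightarrow>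
           gram X $$ (j, k) = 0 \<and> gram X $$ (j, sh k) = 0 \<and> gram X $$ (sh j, sh k) = 0) \<and>
        (\<forall>j\<in>S. \<forall>l\<in>{..<dim_col X} - (S \<union> sh ` S).
           gram X $$ (j, l) = 0 \<and> gram X $$ (sh j, l) = 0))"

end

theory Submission
  imports Defs
begin

text \<open>
  Adding the columns \<open>B\<close> to the true support \<open>T\<close> lowers the residual sum of squares by the squared
  length of the projection of the noise onto at most \<open>card B\<close> orthonormal directions, which has
  exponential moments bounded by \<open>2 ^ card B\<close>. A model that misses \<open>A \<subseteq> T\<close> pays in addition the squared
  length of the part \<open>\<mu>\<close> of the mean it cannot explain, up to a cross term \<open>2 \<mu> \<bullet> \<epsilon>\<close>. On an event
  defined by one tail bound per \<open>B\<close> and one per pair \<open>(A, B)\<close>, both noise terms are dominated by the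
  penalty for \<open>B\<close> and by the signal lost with \<open>A\<close>; the tails are geometric in \<open>card A\<close> and \<open>card B\<close>,
  so the union bound factorises as \<open>(1 + x) ^ card T * (1 + y) ^ (p - card T)\<close>. In each scenario the
  lost signal is at least \<open>card A * n\<close> times \<open>(beta_min \<beta>)\<^sup>2\<close> times a curvature of the Gram matrix,
  at least when \<open>card B \<le> 2 * card A\<close>; for larger \<open>B\<close> the penalty alone decides.
\<close>

section \<open>Exponential moments of sub-Gaussian vectors\<close>

text \<open>The errors need not be Gaussian and their tails are controlled only from t = 2 on, so no
  chi-square law is at hand. All probability therefore passes through one inequality for the
  standardised errors z: E exp <a, z> is at most exp (K |a|^2) for every vector a, with K =
  \<open>mgf_const \<zeta>\<close>. The threshold for lam is an entropy condition: there are up to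
  p^b sets of b added predictors, and the weaker of the two tails, that of the cross term, spends b
  L / 8 at rate 1 / (8 K), where L = ln n + lam ln p is the penalty per predictor; hence lam \<ge>
  64 K. The cutoff between b = card B and a = card A has two sides. If b > 2 a, the saved penalty a
  L is less than half of b L, so no signal is required. If b \<le> 2 a, the model has at most 2 card
  T predictors, which is inside the range where Scenario 2 limits alignment. Columns may be linearly
  dependent and p may exceed n, so projections are built from Gram-Schmidt families and not from
  inverses of Gram matrices.\<close>

lemma exp_le_add_exp_square: "exp x \<le> x + exp (x\<^sup>2)" for x :: real
proof (cases "x \<ge> 1")
  case True
  then have "x \<le> x\<^sup>2" by (simp add: power2_eq_square)
  then show ?thesis using True by (smt (verit) exp_le_cancel_iff)
next
  case False
  have "exp x \<le> 1 + x + x\<^sup>2"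
  proof (cases "x \<ge> 0")
    case True
    then show ?thesis using False exp_bound[of x] by simp
  next
    case neg: False
    \<comment> \<open>The product collapses to 1 - x^3, which is at least 1 for negative x.\<close>
    have "(1 + x + x\<^sup>2) * (1 - x) \<ge> 1"
    proof -
      have "x ^ 3 \<le> 0" using neg by (simp add: power_le_zero_eq)
      then show ?thesis by (simp add: algebra_simps power2_eq_square power3_eq_cube)
    qed
    moreover have "1 - x \<le> exp (- x)" using exp_ge_add_one_self[of "-x"] by simp
    moreover have "1 + x + x\<^sup>2 \<ge> 0" using neg False
      by (smt (verit, best) calculation(1) mult_less_0_iff)
    ultimately have "(1 + x + x\<^sup>2) * exp (-x) \<ge> 1"
      by (meson mult_left_mono order_trans)
    then show ?thesis by (simp add: exp_minus field_simps)
  qed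
  also have "\<dots> \<le> x + exp (x\<^sup>2)" using exp_ge_add_one_self[of "x\<^sup>2"] by simp
  finally show ?thesis .
qed

text \<open>Convexity on the segment from 0 to u. It lets an exponential moment be rescaled:
  shrinking the exponent by t shrinks the excess over 1 at least linearly in t.\<close>

lemma exp_scale_le:
  fixes t u :: real
  assumes "0 \<le> t" "t \<le> 1"
  shows "exp (t * u) \<le> 1 + t * (exp u - 1)"
proof -
  have "exp ((1 - t) *\<^sub>R 0 + t *\<^sub>R u) \<le> (1 - t) * exp 0 + t * exp u"
    by (rule convex_onD[OF exp_convex]) (use assms in auto)
  then show ?thesis by (simp add: algebra_simps)
qed

text \<open>Bounds E exp (Z^2 / (8 \<zeta>^2)). The first summand is the integrand at |Z| = 2, the
  second the geometric series 2 r^k with r = exp (-1 / (2 \<zeta>^2)) from the tail.\<close>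

definition exp_sq_bound :: "real \<Rightarrow> real" where
  "exp_sq_bound \<zeta> = exp (1 / (2 * \<zeta>\<^sup>2)) + 2 / (1 - exp (- (1 / (2 * \<zeta>\<^sup>2))))"

text \<open>The variance proxy K in E exp (s Z) \<le> exp (K s^2).\<close>

definition mgf_const :: "real \<Rightarrow> real" where
  "mgf_const \<zeta> = 8 * \<zeta>\<^sup>2 * exp_sq_bound \<zeta>"

lemma exp_sq_bound_ge_1: "exp_sq_bound \<zeta> \<ge> 1"
proof -
  have "exp (1 / (2 * \<zeta>\<^sup>2)) \<ge> 1" by simp
  moreover have "2 / (1 - exp (- (1 / (2 * \<zeta>\<^sup>2)))) \<ge> 0" by simp
  ultimately show ?thesis unfolding exp_sq_bound_def by linarith
qed

lemma mgf_const_pos: "\<zeta> > 0 \<Longrightarrow> mgf_const \<zeta> > 0"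
  unfolding mgf_const_def using exp_sq_bound_ge_1[of \<zeta>] by simp

text \<open>The range of |Z| is cut into [0, 2] and the shells (k + 2, k + 3]. On a shell the
  integrand is at most its value at k + 3, while the probability is bounded by the tail at k + 2;
  the exponent 1 / (8 \<zeta>^2) is small enough to absorb this shift by one.\<close>

lemma (in prob_space) exp_square_moment:
  fixes Z :: "'a \<Rightarrow> real"
  assumes Z[measurable]: "random_variable borel Z" and "\<zeta> > 0"
    and tail: "\<And>t. 2 \<le> t \<Longrightarrow> prob {x \<in> space M. \<bar>Z x\<bar> > t} \<le> 2 * exp (- ((t / \<zeta>)\<^sup>2))"
  shows "(\<integral>\<^sup>+x. ennreal (exp ((Z x)\<^sup>2 / (8 * \<zeta>\<^sup>2))) \<partial>M) \<le> ennreal (exp_sq_bound \<zeta>)"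
proof -
  define \<eta> where "\<eta> = 1 / (8 * \<zeta>\<^sup>2)"
  have \<eta>: "\<eta> > 0" using \<open>\<zeta> > 0\<close> by (simp add: \<eta>_def)
  define T where "T k = {x \<in> space M. \<bar>Z x\<bar> > real k + 2}" for k :: nat
  have T[measurable]: "T k \<in> sets M" for k unfolding T_def by measurable
  have pw: "ennreal (exp (\<eta> * (Z x)\<^sup>2))
      \<le> ennreal (exp (4 * \<eta>)) + (\<Sum>k. ennreal (exp (\<eta> * (real k + 3)\<^sup>2)) * indicator (T k) x)"
    if x: "x \<in> space M" for x
  proof (cases "\<bar>Z x\<bar> \<le> 2")
    case True
    then have "\<bar>Z x\<bar>\<^sup>2 \<le> 2\<^sup>2" by (intro power_mono) auto
    then have "exp (\<eta> * (Z x)\<^sup>2) \<le> exp (4 * \<eta>)" using \<eta> by simp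
    then have "ennreal (exp (\<eta> * (Z x)\<^sup>2)) \<le> ennreal (exp (4 * \<eta>))" by (intro ennreal_leI)
    then show ?thesis by (meson add_increasing2 zero_le)
  next
    case False
    \<comment> \<open>The k with k + 2 < |Z| \<le> k + 3; the offset 2 is where the assumed tail
      bound begins.\<close>
    define k where "k = nat (\<lceil>\<bar>Z x\<bar>\<rceil> - 3)"
    have "\<lceil>\<bar>Z x\<bar>\<rceil> \<ge> 3" using False by linarith
    then have k: "real k = real_of_int \<lceil>\<bar>Z x\<bar>\<rceil> - 3" by (simp add: k_def)
    have k1: "real k + 2 < \<bar>Z x\<bar>" and k2: "\<bar>Z x\<bar> \<le> real k + 3" unfolding k by linarith+
    have "\<bar>Z x\<bar>\<^sup>2 \<le> (real k + 3)\<^sup>2" using k2 by (intro power_mono) auto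
    then have "exp (\<eta> * (Z x)\<^sup>2) \<le> exp (\<eta> * (real k + 3)\<^sup>2)" using \<eta> by simp
    then have "ennreal (exp (\<eta> * (Z x)\<^sup>2)) \<le> ennreal (exp (\<eta> * (real k + 3)\<^sup>2)) * indicator (T k) x"
      using k1 x by (simp add: T_def ennreal_leI)
    also have "\<dots> \<le> (\<Sum>k. ennreal (exp (\<eta> * (real k + 3)\<^sup>2)) * indicator (T k) x)"
      using sum_le_suminf[OF summableI, of "{k}" "\<lambda>k. ennreal (exp (\<eta> * (real k + 3)\<^sup>2)) * indicator (T k) x"]
      by (simp del: sum_mult_indicator)
    finally show ?thesis by (meson add_increasing zero_le)
  qed
  define r where "r = exp (- (1 / (2 * \<zeta>\<^sup>2)))"
  have r: "0 \<le> r" "r < 1" using \<open>\<zeta> > 0\<close> by (auto simp: r_def)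
  have term_le: "ennreal (exp (\<eta> * (real k + 3)\<^sup>2)) * emeasure M (T k) \<le> ennreal (2 * r ^ k)" for k
  proof -
    have "exp (\<eta> * (real k + 3)\<^sup>2) * prob (T k)
        \<le> exp (\<eta> * (real k + 3)\<^sup>2) * (2 * exp (- (((real k + 2) / \<zeta>)\<^sup>2)))"
      unfolding T_def by (intro mult_left_mono tail) auto
    also have "\<dots> = 2 * exp (\<eta> * (real k + 3)\<^sup>2 - ((real k + 2) / \<zeta>)\<^sup>2)"
      by (simp add: exp_diff exp_minus field_simps)
    also have "\<dots> \<le> 2 * exp (- (real k / (2 * \<zeta>\<^sup>2)))"
    proof -
      \<comment> \<open>The surplus 4 k, multiplied by \<open>\<eta>\<close>, becomes the geometric
        rate k / (2 \<zeta>^2).\<close>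
      have "(real k + 3)\<^sup>2 + 4 * real k \<le> 8 * (real k + 2)\<^sup>2" by (simp add: power2_eq_square algebra_simps)
      then have "\<eta> * ((real k + 3)\<^sup>2 + 4 * real k) \<le> \<eta> * (8 * (real k + 2)\<^sup>2)"
        using \<eta> by (intro mult_left_mono) auto
      then show ?thesis using \<open>\<zeta> > 0\<close> by (simp add: \<eta>_def power_divide divide_simps algebra_simps)
    qed
    also have "\<dots> = 2 * r ^ k" by (simp add: r_def exp_of_nat_mult[symmetric])
    finally have "exp (\<eta> * (real k + 3)\<^sup>2) * prob (T k) \<le> 2 * r ^ k" .
    then show ?thesis
      by (simp add: emeasure_eq_measure ennreal_mult''[symmetric] ennreal_leI)
  qed
  have "(\<integral>\<^sup>+x. ennreal (exp (\<eta> * (Z x)\<^sup>2)) \<partial>M)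
      \<le> (\<integral>\<^sup>+x. ennreal (exp (4 * \<eta>)) + (\<Sum>k. ennreal (exp (\<eta> * (real k + 3)\<^sup>2)) * indicator (T k) x) \<partial>M)"
    by (intro nn_integral_mono pw)
  also have "\<dots> = ennreal (exp (4 * \<eta>)) + (\<Sum>k. ennreal (exp (\<eta> * (real k + 3)\<^sup>2)) * emeasure M (T k))"
    by (simp add: nn_integral_add nn_integral_suminf nn_integral_cmult emeasure_space_1)
  also have "\<dots> \<le> ennreal (exp (4 * \<eta>)) + (\<Sum>k. ennreal (2 * r ^ k))"
    by (intro add_left_mono suminf_le term_le summableI)
  also have "(\<Sum>k. ennreal (2 * r ^ k)) = ennreal (\<Sum>k. 2 * r ^ k)"
    using r by (intro suminf_ennreal2) (auto intro!: summable_mult summable_geometric)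
  also have "(\<Sum>k. 2 * r ^ k) = 2 / (1 - r)"
    using r by (simp add: suminf_mult summable_geometric suminf_geometric)
  also have "ennreal (exp (4 * \<eta>)) + ennreal (2 / (1 - r)) = ennreal (exp_sq_bound \<zeta>)"
    using r by (subst ennreal_plus[symmetric]) (auto simp: exp_sq_bound_def \<eta>_def r_def)
  finally show ?thesis by (simp add: \<eta>_def)
qed

text \<open>Two regimes. For s^2 \<le> \<eta> the bound exp v \<le> v + exp (v^2) at v = s Z
  isolates a linear term that the zero mean removes, and convexity scales the square moment down, so
  no constant factor in front of the exponential survives. For larger s, s Z \<le> s^2 / (4 \<eta>)
  + \<eta> Z^2, at the price of a factor C.\<close>

lemma (in prob_space) subgaussian_mgf:
  fixes Z :: "'a \<Rightarrow> real"
  assumes int: "integrable M Z" and mean: "expectation Z = 0" and "\<zeta> > 0"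
    and tail: "\<And>t. 2 \<le> t \<Longrightarrow> prob {x \<in> space M. \<bar>Z x\<bar> > t} \<le> 2 * exp (- ((t / \<zeta>)\<^sup>2))"
  shows "(\<integral>\<^sup>+x. ennreal (exp (s * Z x)) \<partial>M) \<le> ennreal (exp (mgf_const \<zeta> * s\<^sup>2))"
proof -
  have Z[measurable]: "random_variable borel Z" using int by auto
  define \<eta> where "\<eta> = 1 / (8 * \<zeta>\<^sup>2)"
  have \<eta>: "\<eta> > 0" using \<open>\<zeta> > 0\<close> by (simp add: \<eta>_def)
  define C where "C = exp_sq_bound \<zeta>"
  have C: "C \<ge> 1" using exp_sq_bound_ge_1 by (simp add: C_def)
  have K: "mgf_const \<zeta> * s\<^sup>2 = C * (s\<^sup>2 / \<eta>)" using \<open>\<zeta> > 0\<close> by (simp add: mgf_const_def C_def \<eta>_def)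
  have nn: "(\<integral>\<^sup>+x. ennreal (exp (\<eta> * (Z x)\<^sup>2)) \<partial>M) \<le> ennreal C"
    using exp_square_moment[OF Z \<open>\<zeta> > 0\<close> tail] by (simp add: \<eta>_def C_def)
  have int2: "integrable M (\<lambda>x. exp (\<eta> * (Z x)\<^sup>2))"
    by (rule integrableI_bounded) (use nn in \<open>auto intro: order.strict_trans1\<close>)
  have E: "expectation (\<lambda>x. exp (\<eta> * (Z x)\<^sup>2)) \<le> C"
    using nn C by (subst (asm) nn_integral_eq_integral[OF int2]) auto
  show ?thesis
  proof (cases "s\<^sup>2 \<le> \<eta>")
    case True
    have pw: "exp (s * z) \<le> s * z + (1 + s\<^sup>2 / \<eta> * (exp (\<eta> * z\<^sup>2) - 1))" for z
    proof -
      have "exp (s * z) \<le> s * z + exp ((s * z)\<^sup>2)" by (rule exp_le_add_exp_square)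
      also have "(s * z)\<^sup>2 = s\<^sup>2 / \<eta> * (\<eta> * z\<^sup>2)" using \<eta> by (simp add: power_mult_distrib)
      also have "exp (s\<^sup>2 / \<eta> * (\<eta> * z\<^sup>2)) \<le> 1 + s\<^sup>2 / \<eta> * (exp (\<eta> * z\<^sup>2) - 1)"
        using True \<eta> by (intro exp_scale_le) auto
      finally show ?thesis by simp
    qed
    have int3: "integrable M (\<lambda>x. s * Z x + (1 + s\<^sup>2 / \<eta> * (exp (\<eta> * (Z x)\<^sup>2) - 1)))"
      using int int2 by auto
    have "(\<integral>\<^sup>+x. ennreal (exp (s * Z x)) \<partial>M)
        \<le> (\<integral>\<^sup>+x. ennreal (s * Z x + (1 + s\<^sup>2 / \<eta> * (exp (\<eta> * (Z x)\<^sup>2) - 1))) \<partial>M)"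
      by (intro nn_integral_mono ennreal_leI pw)
    also have "\<dots> = ennreal (expectation (\<lambda>x. s * Z x + (1 + s\<^sup>2 / \<eta> * (exp (\<eta> * (Z x)\<^sup>2) - 1))))"
      by (rule nn_integral_eq_integral[OF int3], rule AE_I2, rule order.trans[OF exp_ge_zero pw])
    also have "expectation (\<lambda>x. s * Z x + (1 + s\<^sup>2 / \<eta> * (exp (\<eta> * (Z x)\<^sup>2) - 1)))
        = 1 + s\<^sup>2 / \<eta> * (expectation (\<lambda>x. exp (\<eta> * (Z x)\<^sup>2)) - 1)"
      using int int2 mean by (simp add: prob_space)
    also have "\<dots> \<le> 1 + s\<^sup>2 / \<eta> * C"
      using E \<eta> by (intro add_left_mono mult_left_mono) auto
    also have "\<dots> \<le> exp (mgf_const \<zeta> * s\<^sup>2)" unfolding K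
      using exp_ge_add_one_self[of "s\<^sup>2 / \<eta> * C"] by (simp add: mult.commute)
    finally show ?thesis by (simp add: ennreal_leI)
  next
    case False
    have pw: "exp (s * z) \<le> exp (s\<^sup>2 / (4 * \<eta>)) * exp (\<eta> * z\<^sup>2)" for z
    proof -
      have "0 \<le> (2 * \<eta> * z - s)\<^sup>2" by simp
      then have "s * z * (4 * \<eta>) \<le> s\<^sup>2 + \<eta> * z\<^sup>2 * (4 * \<eta>)"
        by (simp add: power2_eq_square algebra_simps)
      then have "s * z \<le> s\<^sup>2 / (4 * \<eta>) + \<eta> * z\<^sup>2"
        using \<eta> by (simp add: field_simps)
      then show ?thesis by (simp add: exp_add[symmetric])
    qed
    have "(\<integral>\<^sup>+x. ennreal (exp (s * Z x)) \<partial>M)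
        \<le> (\<integral>\<^sup>+x. ennreal (exp (s\<^sup>2 / (4 * \<eta>))) * ennreal (exp (\<eta> * (Z x)\<^sup>2)) \<partial>M)"
      by (intro nn_integral_mono) (simp add: ennreal_mult''[symmetric] ennreal_leI pw)
    also have "\<dots> = ennreal (exp (s\<^sup>2 / (4 * \<eta>))) * (\<integral>\<^sup>+x. ennreal (exp (\<eta> * (Z x)\<^sup>2)) \<partial>M)"
      by (intro nn_integral_cmult) measurable
    also have "\<dots> \<le> ennreal (exp (s\<^sup>2 / (4 * \<eta>))) * ennreal C"
      by (intro mult_left_mono nn) auto
    also have "\<dots> = ennreal (exp (s\<^sup>2 / (4 * \<eta>)) * C)" using C by (simp add: ennreal_mult)
    \<comment> \<open>The factor C moves into the exponent: C \<le> exp (C - 1), and s^2 / \<eta>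
      exceeds 1 in this regime.\<close>
    also have "exp (s\<^sup>2 / (4 * \<eta>)) * C \<le> exp (s\<^sup>2 / (4 * \<eta>)) * exp ((C - 1) * (s\<^sup>2 / \<eta>))"
    proof (rule mult_left_mono)
      have "(C - 1) * 1 \<le> (C - 1) * (s\<^sup>2 / \<eta>)" using False \<eta> C by (intro mult_left_mono) auto
      then have "exp (C - 1) \<le> exp ((C - 1) * (s\<^sup>2 / \<eta>))" by simp
      then show "C \<le> exp ((C - 1) * (s\<^sup>2 / \<eta>))" using exp_ge_add_one_self[of "C - 1"] by linarith
    qed simp
    also have "\<dots> \<le> exp (mgf_const \<zeta> * s\<^sup>2)"
      unfolding K exp_add[symmetric] using \<eta> C by (simp add: field_simps)
    finally show ?thesis by (simp add: ennreal_leI)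
  qed
qed

text \<open>Vectors are treated as functions of which the first n values count. This spares carrier
  conditions when residuals, basis vectors and random vectors are combined linearly.\<close>

definition ip :: "nat \<Rightarrow> (nat \<Rightarrow> real) \<Rightarrow> (nat \<Rightarrow> real) \<Rightarrow> real" where
  "ip n f g = (\<Sum>i<n. f i * g i)"

lemma ip_commute: "ip n f g = ip n g f"
  by (simp add: ip_def mult.commute)

lemma ip_add_left: "ip n (\<lambda>i. f i + g i) h = ip n f h + ip n g h"
  by (simp add: ip_def sum.distrib algebra_simps)

lemma ip_add_right: "ip n h (\<lambda>i. f i + g i) = ip n h f + ip n h g"
  by (simp add: ip_def sum.distrib algebra_simps)

lemma ip_diff_left: "ip n (\<lambda>i. f i - g i) h = ip n f h - ip n g h"
  by (simp add: ip_def sum_subtractf algebra_simps)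

lemma ip_diff_right: "ip n h (\<lambda>i. f i - g i) = ip n h f - ip n h g"
  by (simp add: ip_def sum_subtractf algebra_simps)

lemma ip_scale_left: "ip n (\<lambda>i. c * f i) h = c * ip n f h"
  by (simp add: ip_def sum_distrib_left algebra_simps)

lemma ip_scale_right: "ip n h (\<lambda>i. c * f i) = c * ip n h f"
  by (simp add: ip_def sum_distrib_left algebra_simps)

lemma ip_sum_left: "ip n (\<lambda>i. \<Sum>k\<in>I. f k i) h = (\<Sum>k\<in>I. ip n (f k) h)"
  unfolding ip_def sum_distrib_right by (rule sum.swap)

lemma ip_sum_right: "ip n h (\<lambda>i. \<Sum>k\<in>I. f k i) = (\<Sum>k\<in>I. ip n h (f k))"
  unfolding ip_def sum_distrib_left by (rule sum.swap)

lemmas ip_linear = ip_add_left ip_add_right ip_diff_left ip_diff_right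
  ip_scale_left ip_scale_right ip_sum_left ip_sum_right

lemma ip_cong: "(\<And>i. i < n \<Longrightarrow> f i = f' i) \<Longrightarrow> (\<And>i. i < n \<Longrightarrow> g i = g' i) \<Longrightarrow> ip n f g = ip n f' g'"
  unfolding ip_def by (intro sum.cong) auto

lemma ip_self_nonneg: "0 \<le> ip n f f"
  by (simp add: ip_def sum_nonneg)

lemma ip_self_eq_0: "ip n f f = 0 \<Longrightarrow> i < n \<Longrightarrow> f i = 0"
  by (simp add: ip_def sum_nonneg_eq_0_iff)

lemma ip_measurable [measurable]:
  assumes "\<And>i. i < n \<Longrightarrow> Z i \<in> borel_measurable M"
  shows "(\<lambda>x. ip n f (\<lambda>i. Z i x)) \<in> borel_measurable M"
  unfolding ip_def using assms by measurable

section \<open>Gaussian integrals and exponential moments of sums of squares\<close>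

lemma nn_integral_normal_density:
  assumes "0 < s"
  shows "(\<integral>\<^sup>+x. ennreal (normal_density m s x) \<partial>lborel) = 1"
  using assms by (subst nn_integral_eq_integral) auto

lemma nn_integral_std_normal_exp:
  "(\<integral>\<^sup>+g. ennreal (std_normal_density g * exp (c * g)) \<partial>lborel) = ennreal (exp (c\<^sup>2 / 2))"
proof -
  have "std_normal_density g * exp (c * g) = exp (c\<^sup>2 / 2) * normal_density c 1 g" for g
    by (simp add: normal_density_def std_normal_density_def exp_add[symmetric] power2_eq_square field_simps)
  then have "(\<integral>\<^sup>+g. ennreal (std_normal_density g * exp (c * g)) \<partial>lborel)
      = (\<integral>\<^sup>+g. ennreal (exp (c\<^sup>2 / 2)) * ennreal (normal_density c 1 g) \<partial>lborel)"
    by (simp add: ennreal_mult)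
  also have "\<dots> = ennreal (exp (c\<^sup>2 / 2))"
    by (simp add: nn_integral_cmult nn_integral_normal_density)
  finally show ?thesis .
qed

text \<open>The integrand is a multiple of the density of a centred Gaussian with variance 2; the
  multiple is the cost of one direction in the moment bound for sums of squares.\<close>

lemma nn_integral_std_normal_exp_sq:
  "(\<integral>\<^sup>+g. ennreal (std_normal_density g * exp (g\<^sup>2 / 4)) \<partial>lborel) = ennreal (sqrt 2)"
proof -
  have "std_normal_density g * exp (g\<^sup>2 / 4) = sqrt 2 * normal_density 0 (sqrt 2) g" for g
    by (simp add: normal_density_def std_normal_density_def exp_add[symmetric] real_sqrt_mult field_simps)
  then have "(\<integral>\<^sup>+g. ennreal (std_normal_density g * exp (g\<^sup>2 / 4)) \<partial>lborel)
      = (\<integral>\<^sup>+g. ennreal (sqrt 2) * ennreal (normal_density 0 (sqrt 2) g) \<partial>lborel)"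
    by (simp add: ennreal_mult)
  also have "\<dots> = ennreal (sqrt 2)"
    by (simp add: nn_integral_cmult nn_integral_normal_density)
  finally show ?thesis .
qed

text \<open>
  Each square is linearised by a standard Gaussian \<open>g\<close> via \<open>exp (c\<^sup>2 / 2) = E exp (c g)\<close>, which moves
  a multiple of \<open>q k\<close> into the linear term; hence the extra \<open>a\<close>, orthogonal to the remaining \<open>q l\<close>.
\<close>
lemma (in prob_space) exp_sum_squares_moment:
  fixes Z :: "nat \<Rightarrow> 'a \<Rightarrow> real" and q :: "'i \<Rightarrow> nat \<Rightarrow> real"
  assumes Z: "\<And>i. i < n \<Longrightarrow> random_variable borel (Z i)" and K: "K > 0"
    and mgf: "\<And>a. (\<integral>\<^sup>+x. ennreal (exp (ip n a (\<lambda>i. Z i x))) \<partial>M) \<le> ennreal (exp (K * ip n a a))"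
    and fin: "finite I"
    and ortho: "\<And>k l. k \<in> I \<Longrightarrow> l \<in> I \<Longrightarrow> ip n (q k) (q l) = (if k = l then 1 else 0)"
    and orth_a: "\<And>k. k \<in> I \<Longrightarrow> ip n a (q k) = 0"
  shows "(\<integral>\<^sup>+x. ennreal (exp (ip n a (\<lambda>i. Z i x)
            + (\<Sum>k\<in>I. (ip n (q k) (\<lambda>i. Z i x))\<^sup>2) / (8 * K))) \<partial>M)
         \<le> ennreal (2 ^ card I * exp (K * ip n a a))"
  using fin ortho orth_a
proof (induction I arbitrary: a rule: finite_induct)
  case empty
  then show ?case using mgf[of a] by simp
next
  case (insert k I)
  note [measurable] = ip_measurable[OF Z]
  \<comment> \<open>Then c^2 / 2 = 1 / (8 K), the weight of the square to be linearised, and K c^2 =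
    1 / 4, below the value 1 / 2 at which the integral over g would diverge.\<close>
  define c where "c = 1 / (2 * sqrt K)"
  have c2: "c\<^sup>2 = 1 / (4 * K)" using K by (simp add: c_def power_divide power_mult_distrib)
  define b where "b g = (\<lambda>i. a i + c * g * q k i)" for g
  define Q where "Q J x = (\<Sum>k\<in>J. (ip n (q k) (\<lambda>i. Z i x))\<^sup>2) / (8 * K)" for J x
  have [measurable]: "Q J \<in> borel_measurable M" for J unfolding Q_def by measurable
  interpret pair_sigma_finite lborel M
    by (simp add: pair_sigma_finite_def sigma_finite_lborel sigma_finite_measure_axioms)
  have qk: "ip n (q k) (q k) = 1" using insert.prems(1)[of k k] by simp
  have ak: "ip n a (q k) = 0" using insert.prems(2)[of k] by simp
  have "(\<integral>\<^sup>+x. ennreal (exp (ip n a (\<lambda>i. Z i x) + Q (insert k I) x)) \<partial>M)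
      = (\<integral>\<^sup>+x. (\<integral>\<^sup>+g. ennreal (std_normal_density g
            * exp (ip n (b g) (\<lambda>i. Z i x) + Q I x)) \<partial>lborel) \<partial>M)"
  proof (rule nn_integral_cong)
    fix x
    let ?z = "\<lambda>i. Z i x"
    have "Q (insert k I) x = Q I x + (c * ip n (q k) ?z)\<^sup>2 / 2"
      unfolding Q_def using insert.hyps by (simp add: power_mult_distrib c2 add_divide_distrib)
    then have "ennreal (exp (ip n a ?z + Q (insert k I) x))
        = ennreal (exp (ip n a ?z + Q I x)) * ennreal (exp ((c * ip n (q k) ?z)\<^sup>2 / 2))"
      by (simp add: exp_add ennreal_mult'' mult_ac)
    also have "\<dots> = (\<integral>\<^sup>+g. ennreal (exp (ip n a ?z + Q I x))
          * ennreal (std_normal_density g * exp ((c * ip n (q k) ?z) * g)) \<partial>lborel)"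
      unfolding nn_integral_std_normal_exp[symmetric]
      by (rule nn_integral_cmult[symmetric]) measurable
    also have "\<dots> = (\<integral>\<^sup>+g. ennreal (std_normal_density g * exp (ip n (b g) ?z + Q I x)) \<partial>lborel)"
      by (intro nn_integral_cong, subst ennreal_mult''[symmetric])
         (auto simp: b_def ip_linear exp_add mult_ac)
    finally show "ennreal (exp (ip n a ?z + Q (insert k I) x)) = \<dots>" .
  qed
  also have "\<dots> = (\<integral>\<^sup>+g. (\<integral>\<^sup>+x. ennreal (std_normal_density g
            * exp (ip n (b g) (\<lambda>i. Z i x) + Q I x)) \<partial>M) \<partial>lborel)"
  proof (rule Fubini')
    have *: "ip n (b g) (\<lambda>i. Z i x) = ip n a (\<lambda>i. Z i x) + c * g * ip n (q k) (\<lambda>i. Z i x)" for g x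
      by (simp add: b_def ip_linear)
    show "(\<lambda>(g, x). ennreal (std_normal_density g * exp (ip n (b g) (\<lambda>i. Z i x) + Q I x)))
        \<in> borel_measurable (lborel \<Otimes>\<^sub>M M)"
      unfolding * by measurable
  qed
  also have "\<dots> \<le> (\<integral>\<^sup>+g. ennreal (std_normal_density g * exp (g\<^sup>2 / 4))
            * ennreal (2 ^ card I * exp (K * ip n a a)) \<partial>lborel)"
  proof (rule nn_integral_mono)
    fix g
    have "(\<integral>\<^sup>+x. ennreal (std_normal_density g * exp (ip n (b g) (\<lambda>i. Z i x) + Q I x)) \<partial>M)
        = ennreal (std_normal_density g) * (\<integral>\<^sup>+x. ennreal (exp (ip n (b g) (\<lambda>i. Z i x) + Q I x)) \<partial>M)"
      by (subst nn_integral_cmult[symmetric]) (auto simp: ennreal_mult)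
    also have "\<dots> \<le> ennreal (std_normal_density g) * ennreal (2 ^ card I * exp (K * ip n (b g) (b g)))"
      unfolding Q_def
    proof (intro mult_left_mono insert.IH)
      fix l assume l: "l \<in> I"
      then have "ip n (q k) (q l) = 0" using insert.prems(1)[of k l] insert.hyps by auto
      then show "ip n (b g) (q l) = 0"
        using insert.prems(2)[of l] l by (simp add: b_def ip_linear)
    qed (use insert.prems in auto)
    \<comment> \<open>Pythagoras: \<open>a\<close> is orthogonal to \<open>q k\<close>, so the shift
      costs exactly (c g)^2.\<close>
    also have "ip n (b g) (b g) = ip n a a + (c * g)\<^sup>2"
      using qk ak by (simp add: b_def ip_linear ip_commute[of n "q k" a] power2_eq_square)
    also have "K * (ip n a a + (c * g)\<^sup>2) = K * ip n a a + g\<^sup>2 / 4"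
      using K by (simp add: power_mult_distrib c2 distrib_left)
    also have "ennreal (std_normal_density g) * ennreal (2 ^ card I * exp (K * ip n a a + g\<^sup>2 / 4))
        = ennreal (std_normal_density g * exp (g\<^sup>2 / 4)) * ennreal (2 ^ card I * exp (K * ip n a a))"
      by (simp add: exp_add ennreal_mult[symmetric] mult_ac)
    finally show "(\<integral>\<^sup>+x. ennreal (std_normal_density g * exp (ip n (b g) (\<lambda>i. Z i x) + Q I x)) \<partial>M) \<le> \<dots>" .
  qed
  also have "\<dots> = ennreal (sqrt 2) * ennreal (2 ^ card I * exp (K * ip n a a))"
    by (subst nn_integral_multc) (auto simp: nn_integral_std_normal_exp_sq)
  also have "\<dots> \<le> ennreal 2 * ennreal (2 ^ card I * exp (K * ip n a a))"
    by (intro mult_right_mono ennreal_leI) (auto intro: real_le_lsqrt)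
  also have "\<dots> = ennreal (2 ^ card (insert k I) * exp (K * ip n a a))"
    using insert.hyps by (subst ennreal_mult''[symmetric]) (auto simp: mult_ac)
  finally show ?case by (simp add: Q_def)
qed

text \<open>Chernoff's bound with exponent 1 / (8 K), applied to the moment bound with linear part
  0. It replaces a chi-square tail: a factor 2 per direction and an exponential rate independent of
  the number of directions.\<close>

lemma (in prob_space) sum_squares_tail:
  fixes Z :: "nat \<Rightarrow> 'a \<Rightarrow> real" and q :: "'i \<Rightarrow> nat \<Rightarrow> real"
  assumes Z: "\<And>i. i < n \<Longrightarrow> random_variable borel (Z i)" and K: "K > 0"
    and mgf: "\<And>a. (\<integral>\<^sup>+x. ennreal (exp (ip n a (\<lambda>i. Z i x))) \<partial>M) \<le> ennreal (exp (K * ip n a a))"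
    and fin: "finite I"
    and ortho: "\<And>k l. k \<in> I \<Longrightarrow> l \<in> I \<Longrightarrow> ip n (q k) (q l) = (if k = l then 1 else 0)"
  shows "prob {x \<in> space M. (\<Sum>k\<in>I. (ip n (q k) (\<lambda>i. Z i x))\<^sup>2) > t} \<le> 2 ^ card I * exp (- (t / (8 * K)))"
proof -
  note [measurable] = ip_measurable[OF Z]
  define Q where "Q x = (\<Sum>k\<in>I. (ip n (q k) (\<lambda>i. Z i x))\<^sup>2)" for x
  have [measurable]: "Q \<in> borel_measurable M" unfolding Q_def by measurable
  have "emeasure M {x \<in> space M. Q x > t} \<le> emeasure M {x \<in> space M. Q x \<ge> t}"
    by (intro emeasure_mono) auto
  also have "\<dots> \<le> ennreal (exp (- (1 / (8 * K)) * t)) * (\<integral>\<^sup>+x\<in>space M. ennreal (exp (1 / (8 * K) * Q x)) \<partial>M)"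
    using K by (intro Chernoff_ineq_nn_integral_ge) auto
  also have "(\<integral>\<^sup>+x\<in>space M. ennreal (exp (1 / (8 * K) * Q x)) \<partial>M) = (\<integral>\<^sup>+x. ennreal (exp (Q x / (8 * K))) \<partial>M)"
    by (intro nn_integral_cong) auto
  also have "\<dots> \<le> ennreal (2 ^ card I)"
    using exp_sum_squares_moment[OF Z K mgf fin ortho, of "\<lambda>_. 0"] by (simp add: Q_def ip_def)
  also have "ennreal (exp (- (1 / (8 * K)) * t)) * ennreal (2 ^ card I) = ennreal (2 ^ card I * exp (- (t / (8 * K))))"
    by (simp add: ennreal_mult''[symmetric] mult_ac)
  finally show ?thesis unfolding Q_def
    by (simp add: emeasure_eq_measure mult_left_mono)
qed

context subgaussian_linear_model
begin

definition std_error :: "nat \<Rightarrow> 'a \<Rightarrow> real" where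
  "std_error i x = \<epsilon> i x / \<sigma>"

lemma error_measurable: "i < n \<Longrightarrow> random_variable borel (\<epsilon> i)"
  using errors_integrable by auto

lemma std_error_measurable: "i < n \<Longrightarrow> random_variable borel (std_error i)"
  unfolding std_error_def[abs_def] using error_measurable by simp

text \<open>This is where independence of the errors enters: the moment of a linear form factorises
  over coordinates. The later noise bounds use only this inequality, for all \<open>a\<close> at
  once.\<close>

lemma mgf_linear:
  assumes "\<zeta> > 0"
  shows "(\<integral>\<^sup>+x. ennreal (exp (ip n a (\<lambda>i. std_error i x))) \<partial>M) \<le> ennreal (exp (mgf_const \<zeta> * ip n a a))"
proof -
  have "(\<integral>\<^sup>+x. ennreal (exp (ip n a (\<lambda>i. std_error i x))) \<partial>M)
      = (\<integral>\<^sup>+x. (\<Prod>i<n. ennreal (exp (a i * std_error i x))) \<partial>M)"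
    by (intro nn_integral_cong) (simp add: ip_def exp_sum prod_ennreal)
  also have "\<dots> = (\<Prod>i<n. \<integral>\<^sup>+x. ennreal (exp (a i * std_error i x)) \<partial>M)"
  proof (rule indep_vars_nn_integral)
    have "indep_vars (\<lambda>_. borel) (\<lambda>i x. (\<lambda>e. ennreal (exp (a i * (e / \<sigma>)))) (\<epsilon> i x)) {..<n}"
      by (rule indep_vars_compose2[OF errors_indep]) measurable
    then show "indep_vars (\<lambda>_. borel) (\<lambda>i x. ennreal (exp (a i * std_error i x))) {..<n}"
      by (simp add: std_error_def)
  qed auto
  also have "\<dots> \<le> (\<Prod>i<n. ennreal (exp (mgf_const \<zeta> * (a i)\<^sup>2)))"
  proof (intro prod_mono_ennreal subgaussian_mgf)
    fix i assume i: "i \<in> {..<n}"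
    show "integrable M (std_error i)" "expectation (std_error i) = 0"
      using i errors_integrable errors_mean by (auto simp: std_error_def[abs_def])
    show "prob {x \<in> space M. \<bar>std_error i x\<bar> > t} \<le> 2 * exp (- ((t / \<zeta>)\<^sup>2))" if "2 \<le> t" for t
      using errors_tail[of i t] i that by (simp add: std_error_def)
  qed (use assms in simp)
  also have "\<dots> = ennreal (exp (mgf_const \<zeta> * ip n a a))"
    by (simp add: prod_ennreal exp_sum[symmetric] ip_def sum_distrib_left power2_eq_square)
  finally show ?thesis .
qed

end


section \<open>Orthonormal families and residual sums of squares\<close>

text \<open>An orthonormal basis q 0, ..., q (m - 1) of the span of the columns x j, j in S, so that
  m is their rank. Indexing by an initial segment allows bases of nested models to share a prefix.
  Basis vectors are combinations of columns at every index, whereas columns are recovered only at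
  the n coordinates that the inner product sees.\<close>

definition onb :: "nat \<Rightarrow> ('j \<Rightarrow> nat \<Rightarrow> real) \<Rightarrow> 'j set \<Rightarrow> nat \<Rightarrow> (nat \<Rightarrow> nat \<Rightarrow> real) \<Rightarrow> bool" where
  "onb n x S m q \<longleftrightarrow>
     (\<forall>k<m. \<forall>l<m. ip n (q k) (q l) = (if k = l then 1 else 0)) \<and>
     (\<forall>k<m. \<exists>d. \<forall>i. q k i = (\<Sum>j\<in>S. d j * x j i)) \<and>
     (\<forall>j\<in>S. \<forall>i<n. x j i = (\<Sum>k<m. ip n (q k) (x j) * q k i))"

lemma onb_empty: "onb n x {} 0 q"
  by (simp add: onb_def)

lemma onb_orthonormal: "onb n x S m q \<Longrightarrow> k < m \<Longrightarrow> l < m \<Longrightarrow> ip n (q k) (q l) = (if k = l then 1 else 0)"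
  by (simp add: onb_def)

lemma onb_combination: "onb n x S m q \<Longrightarrow> k < m \<Longrightarrow> \<exists>d. \<forall>i. q k i = (\<Sum>j\<in>S. d j * x j i)"
  by (simp add: onb_def)

lemma onb_expand: "onb n x S m q \<Longrightarrow> j \<in> S \<Longrightarrow> i < n \<Longrightarrow> x j i = (\<Sum>k<m. ip n (q k) (x j) * q k i)"
  unfolding onb_def by blast

lemma onb_ip_expand:
  assumes "onb n x S m q" "j \<in> S"
  shows "ip n (x j) f = (\<Sum>k<m. ip n (q k) (x j) * ip n (q k) f)"
proof -
  have "ip n (x j) f = ip n (\<lambda>i. \<Sum>k<m. ip n (q k) (x j) * q k i) f"
    by (rule ip_cong) (use onb_expand[OF assms] in auto)
  then show ?thesis by (simp add: ip_linear)
qed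

text \<open>One Gram-Schmidt step. A zero residual means that the new column depends on the old ones
  and the basis stays; otherwise the normalised residual is appended. The old vectors are kept
  literally, which makes residual sums of squares of nested models comparable.\<close>

lemma onb_insert:
  assumes q: "onb n x S m q" and fin: "finite S" and j: "j \<notin> S"
  shows "\<exists>m' q'. m \<le> m' \<and> m' \<le> Suc m \<and> (\<forall>k<m. q' k = q k) \<and> onb n x (insert j S) m' q'"
proof -
  define r where "r i = x j i - (\<Sum>k<m. ip n (q k) (x j) * q k i)" for i
  have qr: "ip n (q l) r = 0" if "l < m" for l
  proof -
    have "(\<Sum>k<m. ip n (q k) (x j) * ip n (q l) (q k)) = (\<Sum>k<m. if k = l then ip n (q k) (x j) else 0)"
      using that by (intro sum.cong) (auto simp: onb_orthonormal[OF q])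
    then show ?thesis unfolding r_def using that by (simp add: ip_linear)
  qed
  have rq: "ip n r (q l) = 0" if "l < m" for l using qr[OF that] by (simp add: ip_commute)
  have xr: "ip n (x l) r = 0" if "l \<in> S" for l
    using onb_ip_expand[OF q that, of r] qr by simp
  have "ip n r r = ip n r (\<lambda>i. x j i - (\<Sum>k<m. ip n (q k) (x j) * q k i))"
    by (simp add: r_def[abs_def])
  also have "\<dots> = ip n r (x j)" by (simp add: ip_linear rq)
  finally have rr: "ip n r (x j) = ip n r r" ..
  have comb: "\<exists>d. \<forall>i. q k i = (\<Sum>l\<in>insert j S. d l * x l i)" if k: "k < m" for k
  proof -
    obtain d where d: "\<forall>i. q k i = (\<Sum>l\<in>S. d l * x l i)" using onb_combination[OF q k] by blast
    have "q k i = (\<Sum>l\<in>insert j S. (d(j := 0)) l * x l i)" for i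
      using d fin j by (simp, intro sum.cong) auto
    then show ?thesis by blast
  qed
  show ?thesis
  proof (cases "ip n r r = 0")
    case True
    then have "r i = 0" if "i < n" for i using ip_self_eq_0 that by blast
    then have "onb n x (insert j S) m q"
      using q comb unfolding onb_def r_def by auto
    then show ?thesis by (intro exI[of _ m] exI[of _ q]) auto
  next
    case False
    define s where "s = sqrt (ip n r r)"
    have s: "s > 0" "s * s = ip n r r"
      using False ip_self_nonneg[of n r] by (auto simp: s_def less_le)
    define q' where "q' = q(m := (\<lambda>i. (1 / s) * r i))"
    have q'm: "q' m = (\<lambda>i. (1 / s) * r i)" and q'k: "\<And>k. k < m \<Longrightarrow> q' k = q k"
      by (auto simp: q'_def)
    have o: "ip n (q' k) (q' l) = (if k = l then 1 else 0)" if "k < Suc m" "l < Suc m" for k l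
    proof -
      have "ip n (\<lambda>i. (1 / s) * r i) (\<lambda>i. (1 / s) * r i) = 1"
        using s(1) by (simp only: ip_linear s(2)[symmetric]) simp
      then show ?thesis using that
        by (cases "k = m"; cases "l = m") (auto simp: q'm q'k qr rq onb_orthonormal[OF q] ip_scale_left ip_scale_right simp del: times_divide_eq_left times_divide_eq_right)
    qed
    have c: "\<exists>d. \<forall>i. q' k i = (\<Sum>l\<in>insert j S. d l * x l i)" if "k < Suc m" for k
    proof (cases "k = m")
      case True
      obtain d where d: "\<And>k i. k < m \<Longrightarrow> q k i = (\<Sum>l\<in>S. d k l * x l i)"
        using onb_combination[OF q] by metis
      \<comment> \<open>Coefficients of the appended vector in the columns: column j minus its
        projection, with each old basis vector expanded in the columns of S.\<close>
      define e where "e l = (1 / s) * (if l = j then 1 else - (\<Sum>k<m. ip n (q k) (x j) * d k l))" for l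
      have "q' k i = (\<Sum>l\<in>insert j S. e l * x l i)" for i
      proof -
        have "(\<Sum>k<m. ip n (q k) (x j) * q k i) = (\<Sum>k<m. ip n (q k) (x j) * (\<Sum>l\<in>S. d k l * x l i))"
          using d by simp
        also have "\<dots> = (\<Sum>l\<in>S. (\<Sum>k<m. ip n (q k) (x j) * d k l) * x l i)"
          unfolding sum_distrib_left sum_distrib_right by (subst sum.swap) (simp add: mult_ac)
        finally have *: "r i = x j i - (\<Sum>l\<in>S. (\<Sum>k<m. ip n (q k) (x j) * d k l) * x l i)"
          by (simp add: r_def)
        have "(\<Sum>l\<in>insert j S. e l * x l i) = e j * x j i + (\<Sum>l\<in>S. e l * x l i)"
          using fin j by simp
        also have "(\<Sum>l\<in>S. e l * x l i) = (\<Sum>l\<in>S. (1 / s) * - ((\<Sum>k<m. ip n (q k) (x j) * d k l) * x l i))"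
          using j by (intro sum.cong) (auto simp: e_def)
        also have "\<dots> = (1 / s) * - (\<Sum>l\<in>S. (\<Sum>k<m. ip n (q k) (x j) * d k l) * x l i)"
          by (simp only: sum_distrib_left sum_negf mult_minus_right)
        finally show ?thesis unfolding True q'm * by (simp add: e_def algebra_simps diff_divide_distrib)
      qed
      then show ?thesis by blast
    next
      case False
      then show ?thesis using comb[of k] that q'k[of k] by simp
    qed
    have "x l i = (\<Sum>k<Suc m. ip n (q' k) (x l) * q' k i)" if "l \<in> insert j S" "i < n" for l i
    proof -
      have eq: "(\<Sum>k<Suc m. ip n (q' k) (x l) * q' k i)
          = (\<Sum>k<m. ip n (q k) (x l) * q k i) + (1 / s) * ip n r (x l) * ((1 / s) * r i)"
        by (simp add: q'm q'k ip_scale_left del: times_divide_eq_left times_divide_eq_right)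
      show ?thesis
      proof (cases "l = j")
        case True
        have "x j i = (\<Sum>k<m. ip n (q k) (x j) * q k i) + (1 / s) * (s * s) * ((1 / s) * r i)"
          using s(1) by (simp add: r_def)
        then show ?thesis unfolding eq unfolding True rr s(2) .
      next
        case False
        then have "l \<in> S" using that by simp
        then show ?thesis unfolding eq using xr[of l] onb_expand[OF q \<open>l \<in> S\<close> \<open>i < n\<close>]
          by (simp add: ip_commute)
      qed
    qed
    then have "onb n x (insert j S) (Suc m) q'" unfolding onb_def using o c by blast
    then show ?thesis using q'k by (intro exI[of _ "Suc m"] exI[of _ q']) auto
  qed
qed

text \<open>The bound m' \<le> m + card B is the count of degrees of freedom behind the factor 2 per
  added predictor in the tail bounds.\<close>

lemma onb_extend:
  assumes q: "onb n x S m q" and fin: "finite S" and "finite B"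
  shows "\<exists>m' q'. m \<le> m' \<and> m' \<le> m + card B \<and> (\<forall>k<m. q' k = q k) \<and> onb n x (S \<union> B) m' q'"
  using \<open>finite B\<close>
proof (induction B rule: finite_induct)
  case empty
  then show ?case using q by auto
next
  case (insert b B)
  then obtain m1 q1 where 1: "m \<le> m1" "m1 \<le> m + card B" "\<forall>k<m. q1 k = q k" "onb n x (S \<union> B) m1 q1"
    by blast
  show ?case
  proof (cases "b \<in> S \<union> B")
    case True
    then have "S \<union> insert b B = S \<union> B" by auto
    then show ?thesis using 1 insert.hyps by (intro exI[of _ m1] exI[of _ q1]) auto
  next
    case False
    obtain m2 q2 where 2: "m1 \<le> m2" "m2 \<le> Suc m1" "\<forall>k<m1. q2 k = q1 k" "onb n x (insert b (S \<union> B)) m2 q2"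
      using onb_insert[OF 1(4) _ False] fin insert.hyps by blast
    show ?thesis using 1 2 insert.hyps by (intro exI[of _ m2] exI[of _ q2]) auto
  qed
qed

lemma onb_exists:
  assumes "finite S"
  shows "\<exists>m q. onb n x S m q"
  using onb_extend[OF onb_empty[of n x "\<lambda>_ _. 0"] finite.emptyI assms] unfolding Un_empty_left by blast

definition resid :: "nat \<Rightarrow> nat \<Rightarrow> (nat \<Rightarrow> nat \<Rightarrow> real) \<Rightarrow> (nat \<Rightarrow> real) \<Rightarrow> nat \<Rightarrow> real" where
  "resid n m q f i = f i - (\<Sum>k<m. ip n (q k) f * q k i)"

lemma ip_resid_basis:
  assumes "onb n x S m q" "l < m"
  shows "ip n (q l) (resid n m q f) = 0"
proof -
  have "(\<Sum>k<m. ip n (q k) f * ip n (q l) (q k)) = (\<Sum>k<m. if k = l then ip n (q k) f else 0)"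
    using assms(2) by (intro sum.cong) (auto simp: onb_orthonormal[OF assms(1)])
  then show ?thesis using assms(2) by (simp add: resid_def[abs_def] ip_linear)
qed

lemma ip_resid_span:
  assumes "onb n x S m q" "j \<in> S"
  shows "ip n (x j) (resid n m q f) = 0"
  using onb_ip_expand[OF assms] ip_resid_basis[OF assms(1)] by simp

lemma ip_resid:
  assumes "onb n x S m q"
  shows "ip n (resid n m q f) (resid n m q g) = ip n (resid n m q f) g"
proof -
  have "ip n (resid n m q f) (resid n m q g)
      = ip n (resid n m q f) g - (\<Sum>k<m. ip n (q k) g * ip n (resid n m q f) (q k))"
    by (subst (2) resid_def[abs_def]) (simp add: ip_linear)
  also have "(\<Sum>k<m. ip n (q k) g * ip n (resid n m q f) (q k)) = 0"
    using ip_resid_basis[OF assms] by (intro sum.neutral) (auto simp: ip_commute)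
  finally show ?thesis by simp
qed

lemma ip_resid_self:
  assumes "onb n x S m q"
  shows "ip n (resid n m q f) (resid n m q f) = ip n f f - (\<Sum>k<m. (ip n (q k) f)\<^sup>2)"
  unfolding ip_resid[OF assms] by (simp add: resid_def[abs_def] ip_linear power2_eq_square)

lemma resid_combination:
  assumes q: "onb n x S m q" and fin: "finite S"
  shows "\<exists>d. \<forall>i. (\<Sum>k<m. ip n (q k) f * q k i) = (\<Sum>j\<in>S. d j * x j i)"
proof -
  obtain d where d: "\<And>k i. k < m \<Longrightarrow> q k i = (\<Sum>l\<in>S. d k l * x l i)"
    using onb_combination[OF q] by metis
  have "(\<Sum>k<m. ip n (q k) f * q k i) = (\<Sum>j\<in>S. (\<Sum>k<m. ip n (q k) f * d k j) * x j i)" for i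
  proof -
    have "(\<Sum>k<m. ip n (q k) f * q k i) = (\<Sum>k<m. ip n (q k) f * (\<Sum>l\<in>S. d k l * x l i))"
      using d by simp
    also have "\<dots> = (\<Sum>l\<in>S. (\<Sum>k<m. ip n (q k) f * d k l) * x l i)"
      unfolding sum_distrib_left sum_distrib_right by (subst sum.swap) (simp add: mult_ac)
    finally show ?thesis .
  qed
  then show ?thesis by (intro exI[of _ "\<lambda>j. \<Sum>k<m. ip n (q k) f * d k j"] allI)
qed

text \<open>An old column expands in the old basis vectors, all orthogonal to a later one. Hence a
  mean in the span of the old columns is invisible to the new directions.\<close>

lemma onb_orth_later:
  assumes q: "onb n x S m q" and q': "onb n x T m' q'" and agree: "\<forall>k<m. q' k = q k"
    and k: "m \<le> k" "k < m'" and j: "j \<in> S"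
  shows "ip n (q' k) (x j) = 0"
proof -
  have "ip n (x j) (q' k) = (\<Sum>l<m. ip n (q l) (x j) * ip n (q l) (q' k))"
    by (rule onb_ip_expand[OF q j])
  also have "\<dots> = 0"
  proof (intro sum.neutral ballI)
    fix l assume "l \<in> {..<m}"
    then show "ip n (q l) (x j) * ip n (q l) (q' k) = 0"
      using onb_orthonormal[OF q', of l k] agree k by auto
  qed
  finally show ?thesis by (simp add: ip_commute)
qed

section \<open>From matrix projections to coordinates\<close>

lemma bij_betw_pick:
  assumes "finite S"
  shows "bij_betw (pick S) {..<card S} S"
proof -
  have inj: "inj_on (pick S) {..<card S}"
    by (rule linorder_inj_onI) (metis lessThan_iff less_irrefl pick_mono_le, auto)
  have "pick S ` {..<card S} \<subseteq> S" using pick_in_set_le by blast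
  moreover have "card (pick S ` {..<card S}) = card S" using inj by (simp add: card_image)
  ultimately have "pick S ` {..<card S} = S" using assms by (metis card_subset_eq)
  then show ?thesis using inj by (simp add: bij_betw_def)
qed

lemma sum_pick:
  assumes "finite S"
  shows "(\<Sum>l<card S. f (pick S l)) = (\<Sum>j\<in>S. f j)"
  by (rule sum.reindex_bij_betw[OF bij_betw_pick[OF assms]])

lemma card_Collect_conj_subset:
  assumes "S \<subseteq> {..<p::nat}"
  shows "card {j. j < p \<and> j \<in> S} = card S"
proof -
  have "{j. j < p \<and> j \<in> S} = S" using assms by auto
  then show ?thesis by simp
qed

lemma cols_at_carrier:
  assumes "X \<in> carrier_mat n p" "S \<subseteq> {..<p}"
  shows "cols_at X S \<in> carrier_mat n (card S)"
  using assms by (intro carrier_matI) (auto simp: cols_at_def dim_submatrix card_Collect_conj_subset)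

lemma cols_at_index:
  assumes "X \<in> carrier_mat n p" "S \<subseteq> {..<p}" "i < n" "l < card S"
  shows "cols_at X S $$ (i, l) = X $$ (i, pick S l)"
  using assms unfolding cols_at_def by (subst submatrix_index) (auto simp: card_Collect_conj_subset pick_UNIV)

lemma cols_at_mult_vec:
  assumes X: "X \<in> carrier_mat n p" and S: "S \<subseteq> {..<p}" and u: "u \<in> carrier_vec (card S)"
    and d: "\<And>l. l < card S \<Longrightarrow> u $ l = d (pick S l)"
  shows "cols_at X S *\<^sub>v u = vec n (\<lambda>i. \<Sum>j\<in>S. d j * X $$ (i, j))"
proof (rule eq_vecI)
  note c = cols_at_carrier[OF X S]
  have fin: "finite S" using S finite_subset by blast
  fix i assume "i < dim_vec (vec n (\<lambda>i. \<Sum>j\<in>S. d j * X $$ (i, j)))"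
  then have i: "i < n" by simp
  have "(cols_at X S *\<^sub>v u) $ i = (\<Sum>l<card S. cols_at X S $$ (i, l) * u $ l)"
    using c u i by (auto simp: scalar_prod_def atLeast0LessThan)
  also have "\<dots> = (\<Sum>l<card S. d (pick S l) * X $$ (i, pick S l))"
    using cols_at_index[OF X S i] d by (intro sum.cong) auto
  also have "\<dots> = (\<Sum>j\<in>S. d j * X $$ (i, j))" by (rule sum_pick[OF fin])
  finally show "(cols_at X S *\<^sub>v u) $ i = vec n (\<lambda>i. \<Sum>j\<in>S. d j * X $$ (i, j)) $ i" using i by simp
qed (use cols_at_carrier[OF X S] in auto)

lemma col_space_cols_at:
  assumes X: "X \<in> carrier_mat n p" and S: "S \<subseteq> {..<p}"
  shows "vec_space.col_space n (cols_at X S) = {w. \<exists>d. w = vec n (\<lambda>i. \<Sum>j\<in>S. d j * X $$ (i, j))}"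
proof -
  note c = cols_at_carrier[OF X S]
  have fin: "finite S" using S finite_subset by blast
  have "(\<exists>u\<in>carrier_vec (card S). cols_at X S *\<^sub>v u = w)
      \<longleftrightarrow> (\<exists>d. w = vec n (\<lambda>i. \<Sum>j\<in>S. d j * X $$ (i, j)))" for w
  proof
    assume "\<exists>u\<in>carrier_vec (card S). cols_at X S *\<^sub>v u = w"
    then obtain u where u: "u \<in> carrier_vec (card S)" "cols_at X S *\<^sub>v u = w" by blast
    \<comment> \<open>Inverting \<open>pick S\<close> turns coefficients by column position into
      coefficients by predictor index.\<close>
    have "u $ l = u $ (inv_into {..<card S} (pick S) (pick S l))" if "l < card S" for l
      using bij_betw_pick[OF fin] that by (simp add: bij_betw_def)
    then show "\<exists>d. w = vec n (\<lambda>i. \<Sum>j\<in>S. d j * X $$ (i, j))"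
      using cols_at_mult_vec[OF X S u(1), of "\<lambda>j. u $ (inv_into {..<card S} (pick S) j)"] u(2)
      by (intro exI[of _ "\<lambda>j. u $ (inv_into {..<card S} (pick S) j)"]) simp
  next
    assume "\<exists>d. w = vec n (\<lambda>i. \<Sum>j\<in>S. d j * X $$ (i, j))"
    then obtain d where "w = vec n (\<lambda>i. \<Sum>j\<in>S. d j * X $$ (i, j))" by blast
    then show "\<exists>u\<in>carrier_vec (card S). cols_at X S *\<^sub>v u = w"
      using cols_at_mult_vec[OF X S, of "vec (card S) (\<lambda>l. d (pick S l))" d]
      by (intro bexI[of _ "vec (card S) (\<lambda>l. d (pick S l))"]) auto
  qed
  then show ?thesis
    unfolding vec_space.col_space_eq[OF c] using c by auto
qed

definition colf :: "real mat \<Rightarrow> nat \<Rightarrow> nat \<Rightarrow> real" where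
  "colf X j i = X $$ (i, j)"

lemma scalar_prod_ip:
  "w \<in> carrier_vec n \<Longrightarrow> v \<bullet> w = ip n (\<lambda>i. v $ i) (\<lambda>i. w $ i)"
  by (auto simp: scalar_prod_def ip_def atLeast0LessThan)

lemma ip_vec_index: "ip n (\<lambda>i. vec n f $ i) g = ip n f g" "ip n g (\<lambda>i. vec n f $ i) = ip n g f"
  by (auto intro: ip_cong)

text \<open>Since \<open>orth_proj\<close> is a definite description, existence and uniqueness are
  both due. The difference of two candidates lies in the column space and is orthogonal to it, hence
  to itself. The formula holds for any orthonormal basis, so convenient ones may be chosen
  later.\<close>

lemma proj_cols_eq:
  assumes X: "X \<in> carrier_mat n p" and S: "S \<subseteq> {..<p}" and v: "v \<in> carrier_vec n"
    and q: "onb n (colf X) S m q"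
  shows "proj_cols X S v = vec n (\<lambda>i. \<Sum>k<m. ip n (q k) (\<lambda>i. v $ i) * q k i)"
proof -
  have fin: "finite S" using S finite_subset by blast
  define W where "W = vec_space.col_space n (cols_at X S)"
  have W: "W = {w. \<exists>d. w = vec n (\<lambda>i. \<Sum>j\<in>S. d j * colf X j i)}"
    unfolding W_def col_space_cols_at[OF X S] by (simp add: colf_def)
  define f where "f = (\<lambda>i. v $ i)"
  define w0 where "w0 = vec n (\<lambda>i. \<Sum>k<m. ip n (q k) f * q k i)"
  have mem: "w0 \<in> W"
  proof -
    obtain d where "\<forall>i. (\<Sum>k<m. ip n (q k) f * q k i) = (\<Sum>j\<in>S. d j * colf X j i)"
      using resid_combination[OF q fin] by blast
    then have "w0 = vec n (\<lambda>i. \<Sum>j\<in>S. d j * colf X j i)" by (simp add: w0_def)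
    then show ?thesis unfolding W by blast
  qed
  have orth: "(v - w0) \<bullet> u = 0" if "u \<in> W" for u
  proof -
    obtain d where d: "u = vec n (\<lambda>i. \<Sum>j\<in>S. d j * colf X j i)" using \<open>u \<in> W\<close> unfolding W by blast
    have "(v - w0) \<bullet> u = ip n (\<lambda>i. (v - w0) $ i) (\<lambda>i. u $ i)"
      by (rule scalar_prod_ip) (simp add: d)
    also have "\<dots> = ip n (resid n m q f) (\<lambda>i. \<Sum>j\<in>S. d j * colf X j i)"
      by (rule ip_cong) (auto simp: d w0_def resid_def f_def)
    also have "\<dots> = (\<Sum>j\<in>S. d j * ip n (colf X j) (resid n m q f))"
      by (simp add: ip_linear ip_commute)
    also have "\<dots> = 0" using ip_resid_span[OF q] by simp
    finally show ?thesis .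
  qed
  have uniq: "w = w0" if w: "w \<in> W" and o: "\<forall>u\<in>W. (v - w) \<bullet> u = 0" for w
  proof -
    obtain d where d: "w = vec n (\<lambda>i. \<Sum>j\<in>S. d j * colf X j i)" using w unfolding W by blast
    obtain d0 where d0: "w0 = vec n (\<lambda>i. \<Sum>j\<in>S. d0 j * colf X j i)" using mem unfolding W by blast
    have "w - w0 = vec n (\<lambda>i. \<Sum>j\<in>S. (d j - d0 j) * colf X j i)"
      unfolding d d0 by (intro eq_vecI) (auto simp: left_diff_distrib sum_subtractf)
    then have dW: "w - w0 \<in> W" unfolding W by (intro CollectI exI[of _ "\<lambda>j. d j - d0 j"])
    have c: "w \<in> carrier_vec n" "w0 \<in> carrier_vec n" by (auto simp: d d0)
    have "(v - w0) \<bullet> (w - w0) - (v - w) \<bullet> (w - w0) = 0" using orth[OF dW] o dW by simp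
    moreover have "(v - w') \<bullet> (w - w0) = ip n (\<lambda>i. v $ i - w' $ i) (\<lambda>i. w $ i - w0 $ i)"
      if "w' \<in> carrier_vec n" for w'
      using c v that by (subst scalar_prod_ip[of _ n]) (auto intro!: ip_cong)
    ultimately have "ip n (\<lambda>i. w $ i - w0 $ i) (\<lambda>i. w $ i - w0 $ i) = 0"
      using c by (simp add: ip_diff_left)
    then have "w $ i - w0 $ i = 0" if "i < n" for i by (rule ip_self_eq_0[OF _ that])
    then show ?thesis using c by (intro eq_vecI) auto
  qed
  have "proj_cols X S v = w0"
    unfolding proj_cols_def orth_proj_def carrier_matD(1)[OF X] W_def[symmetric]
    by (rule the_equality) (use mem orth uniq in blast)+
  then show ?thesis by (simp add: w0_def f_def)
qed

lemma RSS_eq: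
  assumes X: "X \<in> carrier_mat n p" and S: "S \<subseteq> {..<p}"
    and q: "onb n (colf X) S m q"
  shows "RSS X (vec n f) S = ip n f f - (\<Sum>k<m. (ip n (q k) f)\<^sup>2)"
proof -
  have "RSS X (vec n f) S = ip n (resid n m q f) (resid n m q f)"
    unfolding RSS_def sqnorm_def proj_cols_eq[OF X S vec_carrier q] ip_vec_index
    by (subst scalar_prod_ip[of _ n]) (auto intro!: ip_cong simp: resid_def)
  then show ?thesis by (simp add: ip_resid_self[OF q])
qed

lemma sqnorm_proj_cols:
  assumes X: "X \<in> carrier_mat n p" and S: "S \<subseteq> {..<p}"
    and q: "onb n (colf X) S m q"
  shows "sqnorm (proj_cols X S (vec n f)) = (\<Sum>k<m. (ip n (q k) f)\<^sup>2)"
proof -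
  let ?P = "\<lambda>i. \<Sum>k<m. ip n (q k) f * q k i"
  have "sqnorm (proj_cols X S (vec n f)) = ip n ?P ?P"
    unfolding sqnorm_def proj_cols_eq[OF X S vec_carrier q] ip_vec_index
    by (subst scalar_prod_ip[of _ n]) (auto intro!: ip_cong)
  also have "\<dots> = ip n f ?P"
  proof -
    have "ip n (resid n m q f) ?P = (\<Sum>k<m. ip n (q k) f * ip n (q k) (resid n m q f))"
      by (simp add: ip_linear ip_commute)
    also have "\<dots> = 0" using ip_resid_basis[OF q] by simp
    finally show ?thesis by (simp add: resid_def[abs_def] ip_linear)
  qed
  finally show ?thesis by (simp add: ip_linear ip_commute power2_eq_square)
qed


section \<open>The signal missed by a wrong model\<close>

lemma quadratic_form_bounded:
  fixes D :: "real mat"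
  assumes D: "D \<in> carrier_mat m m"
  shows "\<exists>C>0. \<forall>v\<in>carrier_vec m. \<bar>v \<bullet> (D *\<^sub>v v)\<bar> \<le> C * (v \<bullet> v)"
\<comment> \<open>The added 1 keeps the constant positive even for the zero matrix; its reciprocal
  is taken later.\<close>
proof (intro exI[of _ "(\<Sum>i<m. \<Sum>j<m. \<bar>D $$ (i, j)\<bar>) + 1"] conjI ballI)
  show "0 < (\<Sum>i<m. \<Sum>j<m. \<bar>D $$ (i, j)\<bar>) + 1"
    by (intro add_nonneg_pos sum_nonneg) auto
  fix v :: "real vec" assume v: "v \<in> carrier_vec m"
  have vv: "v \<bullet> v = (\<Sum>i<m. (v $ i)\<^sup>2)"
    using v by (auto simp: scalar_prod_def atLeast0LessThan power2_eq_square)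
  have prod_le: "\<bar>v $ i\<bar> * \<bar>v $ j\<bar> \<le> v \<bullet> v" if "i < m" "j < m" for i j
  proof -
    have "(v $ k)\<^sup>2 \<le> v \<bullet> v" if "k < m" for k
      unfolding vv using that by (intro member_le_sum) auto
    then have "(v $ i)\<^sup>2 \<le> v \<bullet> v" "(v $ j)\<^sup>2 \<le> v \<bullet> v" using that by auto
    moreover have "0 \<le> (\<bar>v $ i\<bar> - \<bar>v $ j\<bar>)\<^sup>2" by simp
    ultimately show ?thesis by (simp add: power2_diff)
  qed
  have "v \<bullet> (D *\<^sub>v v) = (\<Sum>i<m. \<Sum>j<m. D $$ (i, j) * (v $ i * v $ j))"
    using v D by (auto simp: scalar_prod_def atLeast0LessThan sum_distrib_left mult_ac intro!: sum.cong)
  also have "\<bar>\<dots>\<bar> \<le> (\<Sum>i<m. \<Sum>j<m. \<bar>D $$ (i, j) * (v $ i * v $ j)\<bar>)"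
    by (rule order.trans[OF sum_abs], rule sum_mono, rule sum_abs)
  also have "\<dots> \<le> (\<Sum>i<m. \<Sum>j<m. \<bar>D $$ (i, j)\<bar> * (v \<bullet> v))"
    using prod_le by (intro sum_mono) (auto simp: abs_mult intro!: mult_left_mono)
  also have "\<dots> \<le> ((\<Sum>i<m. \<Sum>j<m. \<bar>D $$ (i, j)\<bar>) + 1) * (v \<bullet> v)"
    using vv by (simp add: sum_distrib_right[symmetric] distrib_right sum_nonneg)
  finally show "\<bar>v \<bullet> (D *\<^sub>v v)\<bar> \<le> ((\<Sum>i<m. \<Sum>j<m. \<bar>D $$ (i, j)\<bar>) + 1) * (v \<bullet> v)" .
qed

lemma real_vec_self_pos:
  fixes v :: "real vec"
  assumes "v \<in> carrier_vec m" "v \<noteq> 0\<^sub>v m"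
  shows "0 < v \<bullet> v"
proof -
  obtain i where i: "i < m" "v $ i \<noteq> 0" using assms by (metis carrier_vecD eq_vecI index_zero_vec)
  have "0 < (\<Sum>i<m. v $ i * v $ i)"
    using i by (intro sum_pos2[of _ i]) (auto simp: zero_less_mult_iff linorder_neq_iff)
  then show ?thesis using assms by (auto simp: scalar_prod_def atLeast0LessThan)
qed

text \<open>
  The infimum \<open>c\<close> of the quadratic form on the unit sphere is an eigenvalue: otherwise
  \<open>B = A - c 1\<close> is invertible, and positivity of its form at \<open>u - t B\<^sup>-\<^sup>1 u\<close> bounds the form at
  unit vectors \<open>u\<close> away from 0. No compactness is needed.
\<close>
lemma quadratic_form_ge_Min_spectrum:
  fixes A :: "real mat"
  assumes A: "A \<in> carrier_mat m m" and sym: "A\<^sup>T = A" and v: "v \<in> carrier_vec m"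
  shows "Min (spectrum A) * (v \<bullet> v) \<le> v \<bullet> (A *\<^sub>v v)"
proof (cases "v = 0\<^sub>v m")
  case True
  then show ?thesis using A by simp
next
  case False
  define f where "f u = u \<bullet> (A *\<^sub>v u)" for u
  define U where "U = {u \<in> carrier_vec m. u \<bullet> u = (1::real)}"
  define c where "c = Inf (f ` U)"
  obtain C0 where C0: "\<forall>u\<in>carrier_vec m. \<bar>f u\<bar> \<le> C0 * (u \<bullet> u)"
    using quadratic_form_bounded[OF A] unfolding f_def by blast
  have "- C0 \<le> f u" if "u \<in> U" for u
    using bspec[OF C0, of u] that by (simp add: U_def abs_le_iff)
  then have bdd: "bdd_below (f ` U)" by (intro bdd_belowI[of _ "- C0"]) auto
  have scaled: "(1 / sqrt (w \<bullet> w)) \<cdot>\<^sub>v w \<in> U" "f ((1 / sqrt (w \<bullet> w)) \<cdot>\<^sub>v w) = f w / (w \<bullet> w)"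
    if w: "w \<in> carrier_vec m" "w \<noteq> 0\<^sub>v m" for w
  proof -
    have pos: "0 < w \<bullet> w" by (rule real_vec_self_pos[OF w])
    then show "(1 / sqrt (w \<bullet> w)) \<cdot>\<^sub>v w \<in> U" using w by (simp add: U_def)
    show "f ((1 / sqrt (w \<bullet> w)) \<cdot>\<^sub>v w) = f w / (w \<bullet> w)"
      using w A pos by (simp add: f_def mult_mat_vec)
  qed
  have c_le: "c * (w \<bullet> w) \<le> f w" if w: "w \<in> carrier_vec m" for w
  proof (cases "w = 0\<^sub>v m")
    case True
    then show ?thesis using A by (simp add: f_def)
  next
    case ne: False
    have "c \<le> f w / (w \<bullet> w)"
      unfolding c_def scaled(2)[OF w ne, symmetric] using bdd scaled(1)[OF w ne]
      by (intro cInf_lower) auto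
    then show ?thesis using real_vec_self_pos[OF w ne] by (simp add: field_simps)
  qed
  have "c \<in> spectrum A"
  proof (rule ccontr)
    assume "c \<notin> spectrum A"
    define B where "B = A - c \<cdot>\<^sub>m 1\<^sub>m m"
    have B: "B \<in> carrier_mat m m" unfolding B_def by (rule minus_carrier_mat) simp
    have Bv: "B *\<^sub>v w = A *\<^sub>v w - c \<cdot>\<^sub>v w" if "w \<in> carrier_vec m" for w
      using A that by (auto simp: B_def minus_mult_distrib_mat_vec intro!: eq_vecI)
    have "det B \<noteq> 0"
    proof
      assume "det B = 0"
      then obtain w where w: "w \<in> carrier_vec m" "w \<noteq> 0\<^sub>v m" "B *\<^sub>v w = 0\<^sub>v m"
        using det_0_iff_vec_prod_zero[OF B] by blast
      have "A *\<^sub>v w = c \<cdot>\<^sub>v w"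
      proof (rule eq_vecI)
        fix i assume "i < dim_vec (c \<cdot>\<^sub>v w)"
        then have i: "i < m" using w by simp
        have "(A *\<^sub>v w - c \<cdot>\<^sub>v w) $ i = 0" using w(3) i unfolding Bv[OF w(1)] by simp
        then show "(A *\<^sub>v w) $ i = (c \<cdot>\<^sub>v w) $ i" using i w A by simp
      qed (use A w in auto)
      then have "eigenvector A w c" using w A by (simp add: eigenvector_def)
      then show False using \<open>c \<notin> spectrum A\<close> by (auto simp: spectrum_def eigenvalue_def)
    qed
    then obtain D where D: "D \<in> carrier_mat m m" "B * D = 1\<^sub>m m"
      using det_non_zero_imp_unit[OF B] unfolding Units_def ring_mat_def by auto
    obtain C where C: "C > 0" "\<forall>u\<in>carrier_vec m. \<bar>u \<bullet> (D *\<^sub>v u)\<bar> \<le> C * (u \<bullet> u)"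
      using quadratic_form_bounded[OF D(1)] by blast
    have Bsym: "w \<bullet> (B *\<^sub>v u) = (B *\<^sub>v w) \<bullet> u" if "w \<in> carrier_vec m" "u \<in> carrier_vec m" for w u
    proof -
      have "w \<bullet> (A *\<^sub>v u) = (A *\<^sub>v w) \<bullet> u"
        using transpose_vec_mult_scalar[OF A that(2,1)] sym by simp
      then show ?thesis using that A
        by (simp add: Bv scalar_prod_minus_distrib[of _ m] minus_scalar_prod_distrib[of _ m])
    qed
    have Bpos: "0 \<le> w \<bullet> (B *\<^sub>v w)" if "w \<in> carrier_vec m" for w
      using c_le[OF that] A that by (simp add: Bv f_def scalar_prod_minus_distrib[of _ m])
    have gap: "c + 1 / C \<le> f u" if "u \<in> U" for u
    proof -
      have u: "u \<in> carrier_vec m" "u \<bullet> u = 1" using that by (auto simp: U_def)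
      define w where "w = D *\<^sub>v u"
      have w: "w \<in> carrier_vec m" using D u by (simp add: w_def)
      have Bw: "B *\<^sub>v w = u" unfolding w_def
        using assoc_mult_mat_vec[OF B D(1) u(1)] D(2) u by simp
      \<comment> \<open>This t maximises the resulting lower bound 2 t - t^2 C for the form of
        \<open>B\<close> at \<open>u\<close>.\<close>
      define t where "t = 1 / C"
      have tw: "t \<cdot>\<^sub>v w \<in> carrier_vec m" using w by simp
      have e: "B *\<^sub>v (u - t \<cdot>\<^sub>v w) = B *\<^sub>v u - t \<cdot>\<^sub>v u"
        using B u w tw by (simp add: mult_minus_distrib_mat_vec mult_mat_vec Bw)
      have Bu: "B *\<^sub>v u \<in> carrier_vec m" using B u by simp
      have "0 \<le> (u - t \<cdot>\<^sub>v w) \<bullet> (B *\<^sub>v (u - t \<cdot>\<^sub>v w))" by (rule Bpos) (use u w in auto)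
      also have "\<dots> = u \<bullet> (B *\<^sub>v u) - t * (w \<bullet> (B *\<^sub>v u)) - t * (u \<bullet> u) + t * t * (w \<bullet> u)"
        unfolding e using u w tw Bu
        by (simp add: scalar_prod_minus_distrib[of _ m] minus_scalar_prod_distrib[of _ m] algebra_simps)
      also have "w \<bullet> (B *\<^sub>v u) = 1" using Bsym[OF w u(1)] Bw u by simp
      finally have *: "0 \<le> u \<bullet> (B *\<^sub>v u) - t * 1 - t * (u \<bullet> u) + t * t * (w \<bullet> u)" .
      have "w \<bullet> u \<le> C"
        using bspec[OF C(2) u(1)] u w by (simp add: w_def comm_scalar_prod[of _ m])
      then have "t * t * (w \<bullet> u) \<le> t * t * C" using C(1) by (intro mult_left_mono) auto
      then have "0 \<le> u \<bullet> (B *\<^sub>v u) - t * 1 - t * (u \<bullet> u) + t * t * C"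
        using * by linarith
      then have "t \<le> u \<bullet> (B *\<^sub>v u)" using C(1) u by (simp add: t_def)
      then show ?thesis using u A
        by (simp add: Bv f_def t_def scalar_prod_minus_distrib[of _ m])
    qed
    \<comment> \<open>The vector v, being nonzero, makes the sphere nonempty, so the uniform gap 1 /
      C contradicts that c is the infimum.\<close>
    have "U \<noteq> {}" using scaled(1)[OF v False] by blast
    then have "c + 1 / C \<le> c" unfolding c_def
      by (intro cInf_greatest) (use gap in \<open>auto simp: c_def\<close>)
    then show False using C(1) by simp
  qed
  then have "Min (spectrum A) \<le> c"
    using card_finite_spectrum[OF A] by (intro Min_le) auto
  then have "Min (spectrum A) * (v \<bullet> v) \<le> c * (v \<bullet> v)"
    using real_vec_self_pos[OF v False] by (intro mult_right_mono) auto
  then show ?thesis using c_le[OF v] by (simp add: f_def)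
qed

section \<open>Curvature of the Gram matrix in the three scenarios\<close>

lemma ip_colf_gram:
  assumes X: "X \<in> carrier_mat n p" and "n > 0" "j < p" "k < p"
  shows "ip n (colf X j) (colf X k) = n * gram X $$ (j, k)"
  using assms by (simp add: gram_def scalar_prod_def ip_def colf_def atLeast0LessThan)

lemma gram_commute:
  assumes "X \<in> carrier_mat n p" "n > 0" "j < p" "k < p"
  shows "gram X $$ (j, k) = gram X $$ (k, j)"
  using ip_colf_gram[OF assms(1-4)] ip_colf_gram[OF assms(1,2,4,3)] assms(2) ip_commute[of n "colf X j"]
  by simp

lemma ip_combination_gram:
  assumes X: "X \<in> carrier_mat n p" and "n > 0" and T: "T \<subseteq> {..<p}"
  shows "ip n (\<lambda>i. \<Sum>j\<in>T. d j * colf X j i) (\<lambda>i. \<Sum>j\<in>T. d j * colf X j i)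
    = n * (\<Sum>j\<in>T. \<Sum>k\<in>T. d j * d k * gram X $$ (j, k))"
proof -
  have "(\<Sum>k\<in>T. d k * ip n (colf X j) (colf X k)) = n * (\<Sum>k\<in>T. d k * gram X $$ (j, k))" if "j \<in> T" for j
    using that T unfolding sum_distrib_left
    by (intro sum.cong refl) (subst ip_colf_gram[OF X \<open>n > 0\<close>], auto simp: subset_eq)
  then show ?thesis
    by (simp add: ip_linear ip_commute sum_distrib_left mult_ac)
qed

lemma resid_design:
  assumes S: "S \<subseteq> {..<p}" and q: "onb n (colf X) S m q"
  shows "\<exists>d. (\<forall>j. j \<notin> S \<longrightarrow> d j = b j) \<and>
    (\<forall>i. resid n m q (\<lambda>i. \<Sum>j<p. b j * colf X j i) i = (\<Sum>j<p. d j * colf X j i))"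
proof -
  have fin: "finite S" using S finite_subset by blast
  obtain e where e: "\<forall>i. (\<Sum>k<m. ip n (q k) (\<lambda>i. \<Sum>j<p. b j * colf X j i) * q k i) = (\<Sum>j\<in>S. e j * colf X j i)"
    using resid_combination[OF q fin] by blast
  have "(\<Sum>j\<in>S. e j * colf X j i) = (\<Sum>j<p. (if j \<in> S then e j else 0) * colf X j i)" for i
    using S by (intro sum.mono_neutral_cong_left) auto
  then show ?thesis using e
    by (intro exI[of _ "\<lambda>j. b j - (if j \<in> S then e j else 0)"])
       (simp add: resid_def left_diff_distrib sum_subtractf)
qed

text \<open>The squared length of (I - P_S) X b, expressed as the residual sum of squares of the
  noiseless response.\<close>

definition missed_signal :: "real mat \<Rightarrow> (nat \<Rightarrow> real) \<Rightarrow> nat set \<Rightarrow> real" where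
  "missed_signal X b S = RSS X (vec (dim_row X) (\<lambda>i. \<Sum>j<dim_col X. b j * colf X j i)) S"

lemma missed_signal_eq:
  assumes X: "X \<in> carrier_mat n p" and S: "S \<subseteq> {..<p}" and q: "onb n (colf X) S m q"
  shows "missed_signal X b S = ip n (resid n m q (\<lambda>i. \<Sum>j<p. b j * colf X j i))
    (resid n m q (\<lambda>i. \<Sum>j<p. b j * colf X j i))"
  using X unfolding missed_signal_def by (simp add: RSS_eq[OF X S q] ip_resid_self[OF q])

text \<open>Projecting onto the columns of S changes only the coefficients in S. A lower bound for
  the Gram form in terms of the coefficients outside S therefore bounds the missed signal, whatever
  the projection does inside S.\<close>

lemma missed_signal_design:
  assumes X: "X \<in> carrier_mat n p" and S: "S \<subseteq> {..<p}"
  shows "\<exists>d. (\<forall>j. j \<notin> S \<longrightarrow> d j = b j) \<and>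
    missed_signal X b S = ip n (\<lambda>i. \<Sum>j<p. d j * colf X j i) (\<lambda>i. \<Sum>j<p. d j * colf X j i)"
proof -
  obtain m q where q: "onb n (colf X) S m q" using onb_exists finite_subset[OF S] by blast
  obtain d where d: "\<forall>j. j \<notin> S \<longrightarrow> d j = b j"
    "\<And>i. resid n m q (\<lambda>i. \<Sum>j<p. b j * colf X j i) i = (\<Sum>j<p. d j * colf X j i)"
    using resid_design[OF S q, of b] by blast
  show ?thesis using d unfolding missed_signal_eq[OF X S q] by (intro exI[of _ d]) (auto simp: d(2)[abs_def])
qed

text \<open>The Gram form is (1 - \<omega>) times the sum of the d_j^2 plus \<omega> times the
  square of their sum; the second part is nonnegative and is dropped.\<close>

lemma scenario1_missed_signal:
  assumes sc: "scenario1 X \<omega>" and X: "X \<in> carrier_mat n p" and n: "n > 0"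
    and S: "S \<subseteq> {..<p}" and A: "A \<subseteq> {..<p} - S"
  shows "n * (1 - \<omega>) * (\<Sum>j\<in>A. (b j)\<^sup>2) \<le> missed_signal X b S"
proof -
  have \<omega>: "0 \<le> \<omega>" "\<omega> < 1" and G: "gram X = (1 - \<omega>) \<cdot>\<^sub>m 1\<^sub>m p + \<omega> \<cdot>\<^sub>m mat p p (\<lambda>(i, j). 1)"
    using sc X by (auto simp: scenario1_def)
  obtain d where d: "\<forall>j. j \<notin> S \<longrightarrow> d j = b j"
    and ms: "missed_signal X b S = ip n (\<lambda>i. \<Sum>j<p. d j * colf X j i) (\<lambda>i. \<Sum>j<p. d j * colf X j i)"
    using missed_signal_design[OF X S, of b] by blast
  have "(\<Sum>j\<in>A. (b j)\<^sup>2) = (\<Sum>j\<in>A. (d j)\<^sup>2)" using d A by (intro sum.cong) auto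
  also have "\<dots> \<le> (\<Sum>j<p. (d j)\<^sup>2)" using A by (intro sum_mono2) auto
  finally have le: "(1 - \<omega>) * (\<Sum>j\<in>A. (b j)\<^sup>2) \<le> (1 - \<omega>) * (\<Sum>j<p. (d j)\<^sup>2)"
    using \<omega> by (intro mult_left_mono) auto
  have "(\<Sum>j<p. \<Sum>k<p. d j * d k * gram X $$ (j, k))
      = (\<Sum>j<p. \<Sum>k<p. (if j = k then (1 - \<omega>) * (d j)\<^sup>2 else 0) + \<omega> * (d j * d k))"
    by (intro sum.cong) (auto simp: G power2_eq_square algebra_simps)
  also have "\<dots> = (1 - \<omega>) * (\<Sum>j<p. (d j)\<^sup>2) + \<omega> * (\<Sum>j<p. d j)\<^sup>2"
    by (simp add: sum.distrib sum_distrib_left[symmetric] sum_product power2_eq_square)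
  also have "\<dots> \<ge> (1 - \<omega>) * (\<Sum>j<p. (d j)\<^sup>2)" using \<omega> by simp
  finally have "(1 - \<omega>) * (\<Sum>j\<in>A. (b j)\<^sup>2) \<le> (\<Sum>j<p. \<Sum>k<p. d j * d k * gram X $$ (j, k))"
    using le by linarith
  then show ?thesis
    unfolding ms ip_combination_gram[OF X n subset_refl] using n by (simp add: mult.assoc)
qed

text \<open>Let y_j be the signal column j minus \<omega> times its shadow, that is, its residual
  after regression on the shadow. It is orthogonal to every column except j. Pairing the unexplained
  mean with the y_j thus reads off the missed coefficients, and the y_j are orthogonal with squared
  length n (1 - \<omega>^2).\<close>

lemma scenario3_missed_signal:
  assumes sc: "scenario3 X T \<omega>" and X: "X \<in> carrier_mat n p" and n: "n > 0" and T: "T \<subseteq> {..<p}"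
    and S: "S \<subseteq> {..<p}" and A: "A \<subseteq> T - S"
  shows "n * (1 - \<omega>\<^sup>2) * (\<Sum>j\<in>A. (b j)\<^sup>2) \<le> missed_signal X b S"
proof -
  have dc: "dim_col X = p" using X by simp
  have sub: "submatrix (gram X) T T = 1\<^sub>m (card T)" using sc by (simp add: scenario3_def)
  obtain sh where inj: "inj_on sh T" and shT: "sh ` T \<subseteq> {..<p} - T"
    and pair: "\<And>j. j \<in> T \<Longrightarrow> gram X $$ (sh j, sh j) = 1" "\<And>j. j \<in> T \<Longrightarrow> gram X $$ (j, sh j) = \<omega>"
    and cross: "\<And>j k. j \<in> T \<Longrightarrow> k \<in> T \<Longrightarrow> j \<noteq> k \<Longrightarrow>
        gram X $$ (j, k) = 0 \<and> gram X $$ (j, sh k) = 0 \<and> gram X $$ (sh j, sh k) = 0"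
    and rest: "\<And>j l. j \<in> T \<Longrightarrow> l < p \<Longrightarrow> l \<notin> T \<Longrightarrow> l \<notin> sh ` T \<Longrightarrow>
        gram X $$ (j, l) = 0 \<and> gram X $$ (sh j, l) = 0"
    using sc unfolding scenario3_def dc by auto
  have diag: "gram X $$ (j, j) = 1" if j: "j \<in> T" for j
  proof -
    have dim: "dim_row (gram X) = p" "dim_col (gram X) = p" using X by (auto simp: gram_def)
    have "submatrix (gram X) T T $$ (card {a \<in> T. a < j}, card {a \<in> T. a < j}) = gram X $$ (j, j)"
      using j T dim by (intro submatrix_index_card) auto
    moreover have "card {a \<in> T. a < j} < card T"
      using j T by (intro psubset_card_mono) (auto intro: finite_subset)
    ultimately show ?thesis by (simp add: sub)
  qed
  have Tp: "j < p" "sh j < p" "sh j \<notin> T" if "j \<in> T" for j using that T shT by auto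
  define y where "y j = (\<lambda>i. colf X j i - \<omega> * colf X (sh j) i)" for j
  have ipy: "ip n (colf X k) (y j) = (if k = j then n * (1 - \<omega>\<^sup>2) else 0)" if k: "k < p" and j: "j \<in> T" for k j
  proof -
    have "ip n (colf X k) (y j) = n * (gram X $$ (k, j) - \<omega> * gram X $$ (k, sh j))"
      using Tp[OF j] k by (simp add: y_def ip_linear ip_colf_gram[OF X n] right_diff_distrib)
    also have "gram X $$ (k, j) - \<omega> * gram X $$ (k, sh j) = (if k = j then 1 - \<omega>\<^sup>2 else 0)"
    proof -
      consider "k = j" | "k = sh j" | "k \<in> T" "k \<noteq> j" | l where "l \<in> T" "l \<noteq> j" "k = sh l"
        | "k \<notin> T" "k \<notin> sh ` T" by blast
      then show ?thesis
      proof cases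
        case 1
        then show ?thesis using diag[OF j] pair(2)[OF j] by (simp add: power2_eq_square)
      next
        \<comment> \<open>The unit sample variance of the shadow gives \<omega> - \<omega> * 1 =
          0.\<close>
        case 2
        then show ?thesis using pair[OF j] Tp[OF j] j gram_commute[OF X n, of "sh j" j] by auto
      next
        case 3
        then show ?thesis using cross[of k j] j by simp
      next
        case 4
        then show ?thesis
          using cross[of l j] cross[of j l] j Tp[of l] Tp[OF j] gram_commute[OF X n, of "sh l" j] by auto
      next
        case 5
        then show ?thesis
          using rest[OF j k] j Tp[OF j] k gram_commute[OF X n, of k j] gram_commute[OF X n, of k "sh j"] by auto
      qed
    qed
    finally show ?thesis by simp
  qed
  have yy: "ip n (y k) (y j) = (if k = j then n * (1 - \<omega>\<^sup>2) else 0)" if "k \<in> T" "j \<in> T" for k j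
  proof -
    have "ip n (y k) (y j) = ip n (colf X k) (y j) - \<omega> * ip n (colf X (sh k)) (y j)"
      by (simp add: y_def[of k] ip_linear)
    then show ?thesis using ipy[of k j] ipy[of "sh k" j] Tp[OF that(1)] that by auto
  qed
  obtain d where d: "\<forall>j. j \<notin> S \<longrightarrow> d j = b j"
    and ms: "missed_signal X b S = ip n (\<lambda>i. \<Sum>j<p. d j * colf X j i) (\<lambda>i. \<Sum>j<p. d j * colf X j i)"
    using missed_signal_design[OF X S, of b] by blast
  define f where "f = (\<lambda>i. \<Sum>j<p. d j * colf X j i)"
  define w where "w = (\<lambda>i. \<Sum>j\<in>A. b j * y j i)"
  have finA: "finite A" using A T by (meson finite_Diff finite_lessThan finite_subset)
  have AT: "k \<in> T" if "k \<in> A" for k using that A by auto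
  have fy: "ip n f (y j) = b j * (n * (1 - \<omega>\<^sup>2))" if "j \<in> A" for j
  proof -
    have "ip n f (y j) = (\<Sum>k<p. d k * ip n (colf X k) (y j))" by (simp add: f_def ip_linear)
    also have "\<dots> = (\<Sum>k<p. if k = j then d k * (n * (1 - \<omega>\<^sup>2)) else 0)"
      using that A by (intro sum.cong) (auto simp: ipy)
    also have "\<dots> = d j * (n * (1 - \<omega>\<^sup>2))" using that A T by auto
    finally show ?thesis using d that A by auto
  qed
  have wy: "ip n w (y j) = b j * (n * (1 - \<omega>\<^sup>2))" if "j \<in> A" for j
  proof -
    have "ip n w (y j) = (\<Sum>k\<in>A. b k * ip n (y k) (y j))" by (simp add: w_def ip_linear)
    also have "\<dots> = (\<Sum>k\<in>A. if k = j then b k * (n * (1 - \<omega>\<^sup>2)) else 0)"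
      using that AT by (intro sum.cong) (auto simp: yy)
    also have "\<dots> = b j * (n * (1 - \<omega>\<^sup>2))" using that finA by auto
    finally show ?thesis .
  qed
  have gw: "ip n g w = n * (1 - \<omega>\<^sup>2) * (\<Sum>j\<in>A. (b j)\<^sup>2)"
    if "\<And>j. j \<in> A \<Longrightarrow> ip n g (y j) = b j * (n * (1 - \<omega>\<^sup>2))" for g
    using that by (simp add: w_def ip_linear sum_distrib_left power2_eq_square mult_ac)
  \<comment> \<open>By \<open>fy\<close> and \<open>wy\<close> the vector w is the projection of f
    onto the span of the y_j with j in A, so expanding this square yields |f|^2 \<ge> |w|^2.\<close>
  have "0 \<le> ip n (\<lambda>i. f i - w i) (\<lambda>i. f i - w i)" by (rule ip_self_nonneg)
  also have "\<dots> = ip n f f - 2 * ip n f w + ip n w w" by (simp add: ip_linear ip_commute[of n w f])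
  finally show ?thesis unfolding ms f_def[symmetric] using gw[of f, OF fy] gw[of w, OF wy] by simp
qed

text \<open>Coefficients on N are extended by zero to T, so the smallest eigenvalue for T serves
  every subset of T.\<close>

lemma lambda_min_gram:
  assumes X: "X \<in> carrier_mat n p" and n: "n > 0" and T: "T \<subseteq> {..<p}" and N: "N \<subseteq> T"
  shows "n * lambda_min (submatrix (gram X) T T) * (\<Sum>j\<in>N. (b j)\<^sup>2)
    \<le> ip n (\<lambda>i. \<Sum>j\<in>N. b j * colf X j i) (\<lambda>i. \<Sum>j\<in>N. b j * colf X j i)"
proof -
  define G where "G = submatrix (gram X) T T"
  have finT: "finite T" using T finite_subset by blast
  have dim: "dim_row (gram X) = p" "dim_col (gram X) = p" using X by (auto simp: gram_def)
  have G: "G \<in> carrier_mat (card T) (card T)"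
    by (intro carrier_matI) (auto simp: G_def dim_submatrix dim card_Collect_conj_subset[OF T])
  have Gi: "G $$ (i, j) = gram X $$ (pick T i, pick T j)" if "i < card T" "j < card T" for i j
    unfolding G_def by (rule submatrix_index) (use that in \<open>auto simp: dim card_Collect_conj_subset[OF T]\<close>)
  have pT: "pick T i < p" if "i < card T" for i using pick_in_set_le[OF that] T by auto
  have "G\<^sup>T = G"
    using G gram_commute[OF X n pT pT] by (intro eq_matI) (auto simp: Gi)
  define e where "e j = (if j \<in> N then b j else 0)" for j
  define u where "u = vec (card T) (\<lambda>l. e (pick T l))"
  have "u \<bullet> u = (\<Sum>l<card T. (e (pick T l))\<^sup>2)"
    by (simp add: u_def scalar_prod_def atLeast0LessThan power2_eq_square)
  also have "\<dots> = (\<Sum>j\<in>T. (e j)\<^sup>2)" by (rule sum_pick[OF finT])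
  also have "\<dots> = (\<Sum>j\<in>N. (b j)\<^sup>2)"
    using N finT by (intro sum.mono_neutral_cong_right) (auto simp: e_def)
  finally have uu: "u \<bullet> u = (\<Sum>j\<in>N. (b j)\<^sup>2)" .
  have "u \<bullet> (G *\<^sub>v u) = (\<Sum>l<card T. \<Sum>k<card T. e (pick T l) * e (pick T k) * gram X $$ (pick T l, pick T k))"
    using G by (auto simp: u_def scalar_prod_def atLeast0LessThan sum_distrib_left Gi mult_ac intro!: sum.cong)
  also have "\<dots> = (\<Sum>l<card T. \<Sum>k\<in>T. e (pick T l) * e k * gram X $$ (pick T l, k))"
    by (intro sum.cong refl sum_pick[OF finT])
  also have "\<dots> = (\<Sum>j\<in>T. \<Sum>k\<in>T. e j * e k * gram X $$ (j, k))" by (rule sum_pick[OF finT])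
  also have "n * \<dots> = ip n (\<lambda>i. \<Sum>j\<in>T. e j * colf X j i) (\<lambda>i. \<Sum>j\<in>T. e j * colf X j i)"
    by (rule ip_combination_gram[OF X n T, symmetric])
  also have "(\<lambda>i. \<Sum>j\<in>T. e j * colf X j i) = (\<lambda>i. \<Sum>j\<in>N. b j * colf X j i)"
    using N finT by (intro ext sum.mono_neutral_cong_right) (auto simp: e_def)
  finally have uGu: "n * (u \<bullet> (G *\<^sub>v u)) = ip n (\<lambda>i. \<Sum>j\<in>N. b j * colf X j i) (\<lambda>i. \<Sum>j\<in>N. b j * colf X j i)" .
  have "lambda_min G * (u \<bullet> u) \<le> u \<bullet> (G *\<^sub>v u)"
    unfolding lambda_min_def by (rule quadratic_form_ge_Min_spectrum[OF G \<open>G\<^sup>T = G\<close>]) (simp add: u_def)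
  then have "n * (lambda_min G * (u \<bullet> u)) \<le> n * (u \<bullet> (G *\<^sub>v u))" by (intro mult_left_mono) auto
  then show ?thesis unfolding uGu by (simp add: uu G_def mult.assoc)
qed

lemma resid_add_span:
  assumes q: "onb n x S m q" and R: "R \<subseteq> S" and i: "i < n"
  shows "resid n m q (\<lambda>i. g i + (\<Sum>j\<in>R. c j * x j i)) i = resid n m q g i"
proof -
  have "(\<Sum>j\<in>R. c j * x j i) = (\<Sum>j\<in>R. \<Sum>k<m. c j * (ip n (q k) (x j) * q k i))"
  proof (rule sum.cong)
    fix j assume "j \<in> R"
    then have "x j i = (\<Sum>k<m. ip n (q k) (x j) * q k i)" using onb_expand[OF q _ i] R by blast
    then show "c j * x j i = (\<Sum>k<m. c j * (ip n (q k) (x j) * q k i))"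
      unfolding sum_distrib_left[symmetric] by simp
  qed simp
  also have "\<dots> = (\<Sum>k<m. (\<Sum>j\<in>R. c j * ip n (q k) (x j)) * q k i)"
    unfolding sum_distrib_right by (subst sum.swap) (simp add: mult.assoc)
  finally show ?thesis
    by (simp add: resid_def ip_linear distrib_right sum.distrib)
qed

text \<open>The part of the mean carried by columns in S has zero residual, so only the missed
  columns count. The alignment bound leaves a fraction of at least \<open>\<epsilon>0\<close> of
  their squared length, and the eigenvalue bound turns that length into coefficients.\<close>

lemma scenario2_missed_signal:
  assumes sc: "scenario2 X \<beta> lam_star \<kappa>0 \<epsilon>0" and X: "X \<in> carrier_mat n p" and n: "n > 0"
    and \<beta>: "\<beta> \<in> carrier_vec p" and \<epsilon>0: "0 < \<epsilon>0"
    and S: "S \<subseteq> {..<p}" and small: "real (card S) \<le> (1 + \<kappa>0) * real (card (supp_vec \<beta>))"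
    and ne: "supp_vec \<beta> - S \<noteq> {}"
  shows "n * (\<epsilon>0 * lam_star) * (\<Sum>j\<in>supp_vec \<beta> - S. (\<beta> $ j)\<^sup>2) \<le> missed_signal X (\<lambda>j. \<beta> $ j) S"
proof -
  define T where "T = supp_vec \<beta>"
  have T: "T \<subseteq> {..<p}" using \<beta> by (auto simp: T_def supp_vec_def)
  define N where "N = T - S"
  have N: "N \<subseteq> T" "N \<subseteq> {..<p}" using T by (auto simp: N_def)
  define g where "g = (\<lambda>i. \<Sum>j\<in>N. \<beta> $ j * colf X j i)"
  obtain m q where q: "onb n (colf X) S m q" using onb_exists finite_subset[OF S] by blast
  have sv: "subvec \<beta> N \<in> carrier_vec (card N)" "\<And>l. l < card N \<Longrightarrow> subvec \<beta> N $ l = \<beta> $ pick N l"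
    using \<beta> N by (auto simp: subvec_def card_Collect_conj_subset)
  have v: "cols_at X N *\<^sub>v subvec \<beta> N = vec n g"
    using cols_at_mult_vec[OF X N(2) sv(1), of "\<lambda>j. \<beta> $ j"] sv(2) by (simp add: g_def colf_def)
  let ?r = "\<lambda>S. let N = supp_vec \<beta> - S; v = cols_at X N *\<^sub>v subvec \<beta> N
         in sqnorm (proj_cols X S v) / sqnorm v"
  have dc: "dim_col X = p" using X by simp
  let ?F = "{S. S \<subseteq> {..<dim_col X} \<and> real (card S) \<le> (1 + \<kappa>0) * real (card (supp_vec \<beta>)) \<and> supp_vec \<beta> - S \<noteq> {}}"
  \<comment> \<open>Finiteness makes the family of ratios bounded above, without which the supremum
    would bound nothing.\<close>
  have "finite ?F" by (rule finite_subset[of _ "Pow {..<dim_col X}"]) auto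
  then have "?r S \<le> (SUP S\<in>?F. ?r S)"
    using S small ne dc by (intro cSUP_upper bdd_above_finite finite_imageI) auto
  also have "\<dots> \<le> 1 - \<epsilon>0" using sc unfolding scenario2_def by blast
  finally have ratio: "sqnorm (proj_cols X S (vec n g)) / sqnorm (vec n g) \<le> 1 - \<epsilon>0"
    using v by (simp add: Let_def N_def T_def)
  have sqv: "sqnorm (vec n g) = ip n g g"
    unfolding sqnorm_def by (subst scalar_prod_ip[of _ n]) (auto intro!: ip_cong)
  have rg: "ip n (resid n m q g) (resid n m q g) = ip n g g - sqnorm (proj_cols X S (vec n g))"
    by (simp add: ip_resid_self[OF q] sqnorm_proj_cols[OF X S q])
  have frac: "\<epsilon>0 * ip n g g \<le> ip n (resid n m q g) (resid n m q g)"
  \<comment> \<open>With a zero denominator the ratio is 0 by convention and carries no information,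
    but then the claim is that a square is nonnegative.\<close>
  proof (cases "ip n g g = 0")
    case True
    then show ?thesis using ip_self_nonneg[of n "resid n m q g"] by simp
  next
    case False
    then have "0 < ip n g g" using ip_self_nonneg[of n g] by linarith
    then have "sqnorm (proj_cols X S (vec n g)) \<le> (1 - \<epsilon>0) * ip n g g"
      using ratio unfolding sqv by (simp add: field_simps)
    then show ?thesis unfolding rg by (simp add: algebra_simps)
  qed
  have split: "(\<Sum>j<p. \<beta> $ j * colf X j i) = g i + (\<Sum>j\<in>T \<inter> S. \<beta> $ j * colf X j i)" for i
  proof -
    have "(\<Sum>j<p. \<beta> $ j * colf X j i) = (\<Sum>j\<in>T. \<beta> $ j * colf X j i)"
      using T \<beta> by (intro sum.mono_neutral_right) (auto simp: T_def supp_vec_def)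
    also have "\<dots> = (\<Sum>j\<in>N \<union> (T \<inter> S). \<beta> $ j * colf X j i)"
      by (rule arg_cong[where f = "sum _"]) (auto simp: N_def)
    also have "\<dots> = g i + (\<Sum>j\<in>T \<inter> S. \<beta> $ j * colf X j i)" unfolding g_def
      using finite_subset[OF T] by (intro sum.union_disjoint) (auto simp: N_def)
    finally show ?thesis .
  qed
  have "missed_signal X (\<lambda>j. \<beta> $ j) S = ip n (resid n m q g) (resid n m q g)"
    unfolding missed_signal_eq[OF X S q] split
    by (intro ip_cong resid_add_span[OF q]) auto
  moreover have "n * lam_star * (\<Sum>j\<in>N. (\<beta> $ j)\<^sup>2) \<le> ip n g g"
  proof -
    have "lam_star \<le> lambda_min (submatrix (gram X) T T)" using sc by (simp add: scenario2_def T_def)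
    then have "n * lam_star * (\<Sum>j\<in>N. (\<beta> $ j)\<^sup>2) \<le> n * lambda_min (submatrix (gram X) T T) * (\<Sum>j\<in>N. (\<beta> $ j)\<^sup>2)"
      by (intro mult_right_mono mult_left_mono sum_nonneg) auto
    also have "\<dots> \<le> ip n g g" unfolding g_def by (rule lambda_min_gram[OF X n T N(1)])
    finally show ?thesis .
  qed
  then have "\<epsilon>0 * (n * lam_star * (\<Sum>j\<in>N. (\<beta> $ j)\<^sup>2)) \<le> \<epsilon>0 * ip n g g"
    using \<epsilon>0 by (intro mult_left_mono) auto
  ultimately show ?thesis using frac by (simp add: N_def T_def mult_ac)
qed


section \<open>Selection consistency\<close>

text \<open>The residual vector defined through \<open>proj_cols\<close>, so that the noise events
  below do not depend on a choice of basis.\<close>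

definition resv :: "real mat \<Rightarrow> nat set \<Rightarrow> (nat \<Rightarrow> real) \<Rightarrow> nat \<Rightarrow> real" where
  "resv X S f i = (vec (dim_row X) f - proj_cols X S (vec (dim_row X) f)) $ i"

lemma resv_eq_resid:
  assumes X: "X \<in> carrier_mat n p" and S: "S \<subseteq> {..<p}" and q: "onb n (colf X) S m q" and i: "i < n"
  shows "resv X S f i = resid n m q f i"
  using X i by (simp add: resv_def proj_cols_eq[OF X S vec_carrier q] resid_def ip_vec_index)

lemma RSS_add:
  assumes X: "X \<in> carrier_mat n p" and S: "S \<subseteq> {..<p}"
  shows "RSS X (vec n (\<lambda>i. f i + e i)) S
    = RSS X (vec n f) S + 2 * ip n (resv X S f) e + RSS X (vec n e) S"
proof -
  obtain m q where q: "onb n (colf X) S m q" using onb_exists finite_subset[OF S] by blast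
  have "ip n (resv X S f) e = ip n (resid n m q f) e"
    by (intro ip_cong resv_eq_resid[OF X S q]) auto
  also have "\<dots> = ip n f e - (\<Sum>k<m. ip n (q k) f * ip n (q k) e)"
    by (simp add: resid_def[abs_def] ip_linear)
  finally show ?thesis
    unfolding RSS_eq[OF X S q]
    by (simp add: ip_linear ip_commute[of n e f] power2_sum sum.distrib sum_distrib_left mult_ac)
qed

lemma ip_resv_self:
  assumes X: "X \<in> carrier_mat n p" and S: "S \<subseteq> {..<p}"
  shows "ip n (resv X S f) (resv X S f) = RSS X (vec n f) S"
proof -
  obtain m q where q: "onb n (colf X) S m q" using onb_exists finite_subset[OF S] by blast
  have "ip n (resv X S f) (resv X S f) = ip n (resid n m q f) (resid n m q f)"
    by (intro ip_cong resv_eq_resid[OF X S q]) auto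
  then show ?thesis by (simp add: RSS_eq[OF X S q] ip_resid_self[OF q])
qed

lemma RSS_antimono:
  assumes X: "X \<in> carrier_mat n p" and "S \<subseteq> S'" and S': "S' \<subseteq> {..<p}"
  shows "RSS X (vec n f) S' \<le> RSS X (vec n f) S"
proof -
  have S: "S \<subseteq> {..<p}" using assms by blast
  obtain m q where q: "onb n (colf X) S m q" using onb_exists finite_subset[OF S] by blast
  obtain m' q' where m': "m \<le> m'" and agree: "\<forall>k<m. q' k = q k" and "onb n (colf X) (S \<union> S') m' q'"
    using onb_extend[OF q] finite_subset[OF S] finite_subset[OF S'] by blast
  then have q': "onb n (colf X) S' m' q'" using \<open>S \<subseteq> S'\<close> by (simp add: Un_absorb1)
  have "(\<Sum>k<m. (ip n (q k) f)\<^sup>2) = (\<Sum>k<m. (ip n (q' k) f)\<^sup>2)" using agree by simp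
  also have "\<dots> \<le> (\<Sum>k<m'. (ip n (q' k) f)\<^sup>2)" using m' by (intro sum_mono2) auto
  finally show ?thesis by (simp add: RSS_eq[OF X S q] RSS_eq[OF X S' q'])
qed

text \<open>The directions are the basis vectors gained when passing from T to the union with B.
  They are orthogonal to the columns of T, so the mean drops out, and they are fixed before
  \<open>c\<close> and \<open>e\<close>, so one deterministic family serves all outcomes.\<close>

lemma overfit_gain_sum_squares:
  assumes X: "X \<in> carrier_mat n p" and T: "T \<subseteq> {..<p}" and B: "B \<subseteq> {..<p}"
  shows "\<exists>I (q :: nat \<Rightarrow> nat \<Rightarrow> real). finite I \<and> card I \<le> card B \<and>
    (\<forall>k\<in>I. \<forall>l\<in>I. ip n (q k) (q l) = (if k = l then 1 else 0)) \<and>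
    (\<forall>c e. RSS X (vec n (\<lambda>i. (\<Sum>j\<in>T. c j * colf X j i) + e i)) T
         - RSS X (vec n (\<lambda>i. (\<Sum>j\<in>T. c j * colf X j i) + e i)) (T \<union> B) = (\<Sum>k\<in>I. (ip n (q k) e)\<^sup>2))"
proof -
  have TB: "T \<union> B \<subseteq> {..<p}" using T B by simp
  obtain m q where q: "onb n (colf X) T m q" using onb_exists finite_subset[OF T] by blast
  obtain m' q' where m': "m \<le> m'" "m' \<le> m + card B" and agree: "\<forall>k<m. q' k = q k"
    and q': "onb n (colf X) (T \<union> B) m' q'"
    using onb_extend[OF q] finite_subset[OF T] finite_subset[OF B] by blast
  have "RSS X (vec n (\<lambda>i. (\<Sum>j\<in>T. c j * colf X j i) + e i)) T
         - RSS X (vec n (\<lambda>i. (\<Sum>j\<in>T. c j * colf X j i) + e i)) (T \<union> B) = (\<Sum>k\<in>{m..<m'}. (ip n (q' k) e)\<^sup>2)"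
    for c e
  proof -
    define f where "f = (\<lambda>i. (\<Sum>j\<in>T. c j * colf X j i) + e i)"
    have "{..<m'} = {..<m} \<union> {m..<m'}" using m' by auto
    then have "(\<Sum>k<m'. (ip n (q' k) f)\<^sup>2) = (\<Sum>k<m. (ip n (q' k) f)\<^sup>2) + (\<Sum>k\<in>{m..<m'}. (ip n (q' k) f)\<^sup>2)"
      by (simp add: sum.union_disjoint ivl_disj_int)
    moreover have "(\<Sum>k<m. (ip n (q' k) f)\<^sup>2) = (\<Sum>k<m. (ip n (q k) f)\<^sup>2)" using agree by simp
    moreover have "(\<Sum>k\<in>{m..<m'}. (ip n (q' k) f)\<^sup>2) = (\<Sum>k\<in>{m..<m'}. (ip n (q' k) e)\<^sup>2)"
      using onb_orth_later[OF q q' agree] by (intro sum.cong) (auto simp: f_def ip_linear)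
    ultimately show ?thesis
      unfolding f_def[symmetric] RSS_eq[OF X T q] RSS_eq[OF X TB q'] by simp
  qed
  moreover have "\<forall>k\<in>{m..<m'}. \<forall>l\<in>{m..<m'}. ip n (q' k) (q' l) = (if k = l then 1 else 0)"
    using onb_orthonormal[OF q'] by simp
  ultimately show ?thesis using m' by (intro exI[of _ "{m..<m'}"] exI[of _ q']) auto
qed

section \<open>Sums over subsets for the union bound\<close>

lemma sum_power_card_Pow:
  fixes y :: "'b :: comm_semiring_1"
  assumes "finite D"
  shows "(\<Sum>B\<in>Pow D. y ^ card B) = (1 + y) ^ card D"
  using prod_add[OF assms, of "\<lambda>_. y" "\<lambda>_. 1"] by (simp add: add.commute)

lemma sum_power_card_Pow_le:
  fixes y :: real
  assumes "finite D" "0 \<le> y" "card D \<le> p"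
  shows "(\<Sum>B\<in>Pow D. y ^ card B) \<le> exp (p * y)"
proof -
  have "(1 + y) ^ card D \<le> exp y ^ card D"
    using assms exp_ge_add_one_self[of y] by (intro power_mono) auto
  also have "\<dots> = exp (card D * y)" by (simp add: exp_of_nat_mult)
  also have "\<dots> \<le> exp (p * y)" using assms by (simp add: mult_right_mono)
  finally show ?thesis using assms by (simp add: sum_power_card_Pow)
qed

lemma sum_power_card_nonempty_le:
  fixes y :: real
  assumes "finite D" "0 \<le> y" "card D \<le> p"
  shows "(\<Sum>B\<in>Pow D - {{}}. y ^ card B) \<le> exp (p * y) - 1"
proof -
  have "(\<Sum>B\<in>Pow D - {{}}. y ^ card B) = (\<Sum>B\<in>Pow D. y ^ card B) - 1"
    using assms by (simp add: sum_diff1)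
  then show ?thesis using sum_power_card_Pow_le[OF assms] by simp
qed

lemma beta_min_le:
  assumes "j \<in> supp_vec \<beta>"
  shows "(beta_min \<beta>)\<^sup>2 \<le> (\<beta> $ j)\<^sup>2"
proof -
  have fin: "finite (supp_vec \<beta>)" by (simp add: supp_vec_def)
  have "0 \<le> beta_min \<beta>" unfolding beta_min_def using fin assms by (subst Min_ge_iff) auto
  moreover have "beta_min \<beta> \<le> \<bar>\<beta> $ j\<bar>" unfolding beta_min_def using fin assms by (intro Min_le) auto
  ultimately have "(beta_min \<beta>)\<^sup>2 \<le> \<bar>\<beta> $ j\<bar>\<^sup>2" by (intro power_mono)
  then show ?thesis by simp
qed

text \<open>With r = n powr (- \<theta> / 8), this is (exp (2 r) - 1) + 2 (exp (1 / n) - 1) exp r: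
  the first summand covers overfitting, the second the cross terms. It involves neither p nor the
  design.\<close>

definition failure_bound :: "real \<Rightarrow> nat \<Rightarrow> real" where
  "failure_bound \<theta> n = (exp (2 * exp (- (\<theta> / 8 * ln n))) - 1)
     + 2 * (exp (1 / n) - 1) * exp (exp (- (\<theta> / 8 * ln n)))"

lemma failure_bound_tendsto_0:
  assumes "\<theta> > 0"
  shows "failure_bound \<theta> \<longlonglongrightarrow> 0"
proof -
  have "filterlim (\<lambda>n. \<theta> / 8 * ln (real n)) at_top sequentially"
    using assms by (intro filterlim_tendsto_pos_mult_at_top[OF tendsto_const]
        filterlim_compose[OF ln_at_top filterlim_real_sequentially]) auto
  then have "(\<lambda>n. exp (- (\<theta> / 8 * ln (real n)))) \<longlonglongrightarrow> 0"
    by (intro filterlim_compose[OF exp_at_bot] filterlim_compose[OF filterlim_uminus_at_bot_at_top])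
  then have "failure_bound \<theta> \<longlonglongrightarrow> (exp (2 * 0) - 1) + 2 * (exp 0 - 1) * exp 0"
    unfolding failure_bound_def[abs_def]
    by (intro tendsto_intros lim_1_over_n)
  then show ?thesis by simp
qed

section \<open>Noise events and the comparison of models\<close>

context subgaussian_linear_model
begin

abbreviation "T \<equiv> supp_vec \<beta>"

definition mean_response :: "nat \<Rightarrow> real" where
  "mean_response i = (\<Sum>j<p. \<beta> $ j * colf X j i)"

abbreviation "Y x \<equiv> response X \<beta> \<epsilon> x"

lemma T_subset: "T \<subseteq> {..<p}"
  using beta_dim by (auto simp: supp_vec_def)

lemma mean_response_supp: "mean_response i = (\<Sum>j\<in>T. \<beta> $ j * colf X j i)"
  unfolding mean_response_def using beta_dim
  by (intro sum.mono_neutral_right) (auto simp: supp_vec_def)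

lemma response_eq: "Y x = vec n (\<lambda>i. mean_response i + \<sigma> * std_error i x)"
  using X_dim beta_dim sigma_pos
  by (intro eq_vecI)
     (auto simp: response_def mean_response_def colf_def std_error_def scalar_prod_def atLeast0LessThan mult.commute)

lemma missed_signal_mean_response: "missed_signal X (\<lambda>j. \<beta> $ j) S = RSS X (vec n mean_response) S"
  using X_dim by (simp add: missed_signal_def mean_response_def[abs_def])

lemma RSS_measurable:
  assumes S: "S \<subseteq> {..<p}"
  shows "(\<lambda>x. RSS X (Y x) S) \<in> borel_measurable M"
proof -
  obtain m q where q: "onb n (colf X) S m q" using onb_exists finite_subset[OF S] by blast
  have *: "(\<lambda>x. mean_response i + \<sigma> * std_error i x) \<in> borel_measurable M" if "i < n" for i
    using std_error_measurable[OF that] by simp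
  have "(\<lambda>x. ip n (\<lambda>i. mean_response i + \<sigma> * std_error i x) (\<lambda>i. mean_response i + \<sigma> * std_error i x)) \<in> borel_measurable M"
    unfolding ip_def by (intro borel_measurable_sum borel_measurable_times *) auto
  moreover have "(\<lambda>x. ip n (q k) (\<lambda>i. mean_response i + \<sigma> * std_error i x)) \<in> borel_measurable M" for k
    by (rule ip_measurable) (rule *)
  ultimately show ?thesis unfolding response_eq RSS_eq[OF X_dim S q] by measurable
qed

lemma selection_prob_eq:
  "selection_prob M X \<beta> \<sigma> \<epsilon> lam
    = prob {x \<in> space M. \<forall>S\<in>Pow {..<p} - {T}. DCIC lam \<sigma> X (Y x) T < DCIC lam \<sigma> X (Y x) S}"
proof -
  have dc: "dim_col X = p" using X_dim by simp
  let ?F = "{S. S \<subseteq> {..<p} \<and> S \<noteq> T}"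
  have F: "?F = Pow {..<p} - {T}" by auto
  have ne: "?F \<noteq> {}"
  proof (cases "T = {}")
    case True
    \<comment> \<open>For an empty support, p \<ge> 1 supplies a competitor, so the minimum is over
      a nonempty family.\<close>
    then have "{0} \<in> ?F" using p_pos by auto
    then show ?thesis by blast
  qed auto
  have fin: "finite ?F" unfolding F by simp
  show ?thesis unfolding selection_prob_def dc
    by (subst Min_gr_iff) (use fin ne in \<open>auto simp: F\<close>)
qed

lemma selection_set_measurable:
  "{x \<in> space M. \<forall>S\<in>Pow {..<p} - {T}. DCIC lam \<sigma> X (Y x) T < DCIC lam \<sigma> X (Y x) S} \<in> events"
proof -
  have D: "(\<lambda>x. DCIC lam \<sigma> X (Y x) S) \<in> borel_measurable M" if "S \<subseteq> {..<p}" for S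
    unfolding DCIC_def using RSS_measurable[OF that] by measurable
  have "{x \<in> space M. DCIC lam \<sigma> X (Y x) T < DCIC lam \<sigma> X (Y x) S} \<in> events" if "S \<subseteq> {..<p}" for S
    using D[OF T_subset] D[OF that] by measurable
  then show ?thesis by (intro sets.sets_Collect_finite_All) auto
qed

text \<open>\<open>L\<close> stands for the penalty per predictor; on the complement the overfitting
  gain is at most a quarter of the penalty for B.\<close>

definition overfit_event :: "real \<Rightarrow> nat set \<Rightarrow> 'a set" where
  "overfit_event L B = {x \<in> space M. (RSS X (Y x) T - RSS X (Y x) (T \<union> B)) / \<sigma>\<^sup>2 > real (card B) * L / 4}"

text \<open>The square of the linear form along the normalised missed mean exceeds t. Multiplying
  out the normalisation makes the event empty when nothing is missed.\<close>

definition linear_event :: "real \<Rightarrow> nat set \<Rightarrow> 'a set" where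
  "linear_event t S = {x \<in> space M. (ip n (resv X S mean_response) (\<lambda>i. std_error i x))\<^sup>2 > RSS X (vec n mean_response) S * t}"

lemma overfit_event_measurable: "B \<subseteq> {..<p} \<Longrightarrow> overfit_event L B \<in> events"
  unfolding overfit_event_def using RSS_measurable[OF T_subset] RSS_measurable[of "T \<union> B"] T_subset
  by (auto intro!: borel_measurable_less)

lemma linear_event_measurable: "linear_event t S \<in> events"
  unfolding linear_event_def using ip_measurable[OF std_error_measurable] by measurable

lemma overfit_event_prob:
  assumes "\<zeta> > 0" and B: "B \<subseteq> {..<p}"
  shows "prob (overfit_event L B) \<le> (2 * exp (- (L / 4 / (8 * mgf_const \<zeta>)))) ^ card B"
proof -
  define K where "K = mgf_const \<zeta>"
  have K: "K > 0" using mgf_const_pos[OF \<open>\<zeta> > 0\<close>] by (simp add: K_def)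
  obtain I and q :: "nat \<Rightarrow> nat \<Rightarrow> real" where I: "finite I" "card I \<le> card B"
    and o: "\<And>k l. k \<in> I \<Longrightarrow> l \<in> I \<Longrightarrow> ip n (q k) (q l) = (if k = l then 1 else 0)"
    and g: "\<And>c e. RSS X (vec n (\<lambda>i. (\<Sum>j\<in>T. c j * colf X j i) + e i)) T
         - RSS X (vec n (\<lambda>i. (\<Sum>j\<in>T. c j * colf X j i) + e i)) (T \<union> B) = (\<Sum>k\<in>I. (ip n (q k) e)\<^sup>2)"
    using overfit_gain_sum_squares[OF X_dim T_subset B] by blast
  have Q: "(RSS X (Y x) T - RSS X (Y x) (T \<union> B)) / \<sigma>\<^sup>2 = (\<Sum>k\<in>I. (ip n (q k) (\<lambda>i. std_error i x))\<^sup>2)" for x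
  proof -
    have "RSS X (Y x) T - RSS X (Y x) (T \<union> B) = (\<Sum>k\<in>I. (ip n (q k) (\<lambda>i. \<sigma> * std_error i x))\<^sup>2)"
      unfolding response_eq mean_response_supp by (rule g)
    also have "\<dots> = \<sigma>\<^sup>2 * (\<Sum>k\<in>I. (ip n (q k) (\<lambda>i. std_error i x))\<^sup>2)"
      by (simp add: ip_scale_right power_mult_distrib sum_distrib_left)
    finally show ?thesis using sigma_pos by simp
  qed
  have "prob (overfit_event L B) \<le> 2 ^ card I * exp (- (real (card B) * L / 4 / (8 * K)))"
    unfolding overfit_event_def Q
    by (rule sum_squares_tail[OF std_error_measurable K mgf_linear[OF \<open>\<zeta> > 0\<close>, folded K_def] I(1) o])
  also have "\<dots> \<le> 2 ^ card B * exp (- (real (card B) * L / 4 / (8 * K)))"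
    using I by (intro mult_right_mono power_increasing) auto
  also have "\<dots> = (2 * exp (- (L / 4 / (8 * K)))) ^ card B"
    by (simp add: power_mult_distrib exp_of_nat_mult[symmetric])
  finally show ?thesis by (simp add: K_def)
qed

text \<open>The tail bound for sums of squares with a single direction, the missed mean scaled to
  unit length.\<close>

lemma linear_event_prob:
  assumes "\<zeta> > 0" and S: "S \<subseteq> {..<p}" and "t \<ge> 0"
  shows "prob (linear_event t S) \<le> 2 * exp (- (t / (8 * mgf_const \<zeta>)))"
proof -
  define K where "K = mgf_const \<zeta>"
  have K: "K > 0" using mgf_const_pos[OF \<open>\<zeta> > 0\<close>] by (simp add: K_def)
  define \<mu> where "\<mu> = resv X S mean_response"
  define s where "s = RSS X (vec n mean_response) S"
  have s: "ip n \<mu> \<mu> = s" unfolding \<mu>_def s_def by (rule ip_resv_self[OF X_dim S])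
  show ?thesis
  proof (cases "s = 0")
    case True
    then have "\<mu> i = 0" if "i < n" for i using s ip_self_eq_0[OF _ that] by simp
    then have "ip n \<mu> g = 0" for g by (simp add: ip_def)
    then have "linear_event t S = {}"
      using True by (simp add: linear_event_def \<mu>_def s_def)
    then show ?thesis by simp
  next
    case False
    then have pos: "s > 0" using s ip_self_nonneg[of n \<mu>] by simp
    define u where "u = (\<lambda>i. (1 / sqrt s) * \<mu> i)"
    have ipu: "ip n u g = (1 / sqrt s) * ip n \<mu> g" for g unfolding u_def by (rule ip_scale_left)
    have "ip n u u = (1 / sqrt s) * ((1 / sqrt s) * s)"
      unfolding ipu by (subst u_def, subst ip_scale_right) (simp add: s)
    then have uu: "ip n u u = 1" using pos by (simp add: field_simps)
    have "linear_event t S = {x \<in> space M. (\<Sum>k\<in>{()}. (ip n u (\<lambda>i. std_error i x))\<^sup>2) > t}"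
      unfolding linear_event_def \<mu>_def[symmetric] s_def[symmetric] ipu
      using pos by (auto simp: power_mult_distrib power_divide field_simps)
    then show ?thesis
      using sum_squares_tail[OF std_error_measurable K mgf_linear[OF \<open>\<zeta> > 0\<close>, folded K_def], of "{()}" "\<lambda>_. u" t] uu
      by (simp add: K_def)
  qed
qed

lemma RSS_response_overfit:
  assumes "T \<subseteq> U" and U: "U \<subseteq> {..<p}"
  shows "RSS X (Y x) U = RSS X (vec n (\<lambda>i. \<sigma> * std_error i x)) U"
proof -
  obtain m q where q: "onb n (colf X) U m q" using onb_exists finite_subset[OF U] by blast
  have "resv X U mean_response i = 0" if i: "i < n" for i
  proof -
    have "resv X U mean_response i = resid n m q (\<lambda>i. 0 + (\<Sum>j\<in>T. \<beta> $ j * colf X j i)) i"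
      unfolding resv_eq_resid[OF X_dim U q i] by (simp add: mean_response_supp[abs_def])
    also have "\<dots> = resid n m q (\<lambda>_. 0) i" by (rule resid_add_span[OF q assms(1) i])
    finally show ?thesis by (simp add: resid_def ip_def)
  qed
  then have "ip n (resv X U mean_response) g = 0" for g by (simp add: ip_def)
  then show ?thesis unfolding response_eq RSS_add[OF X_dim U] ip_resv_self[OF X_dim U, symmetric] by simp
qed

text \<open>The deterministic core. With a missed and b added predictors and b \<le> 2 a, the noise
  costs at most 2 (b L / 8 + k a N) + b L / 4, whose b-part b L / 2 is covered by the penalty b L.
  What remains is c a N / 2 of signal against 2 k a N of noise and a saved penalty of at most lam a
  N, hence the condition on \<open>c\<close>.\<close>

lemma selects_truth:
  fixes lam k c :: real and x :: 'a
  defines "N \<equiv> ln (real p) + ln (real n)"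
  defines "L \<equiv> ln (real n) + lam * ln (real p)"
  assumes n: "n \<ge> 2" and lam: "lam \<ge> 1" and k: "k \<ge> 0" and c: "c > 2 * (2 * k + lam)" and x: "x \<in> space M"
    and signal: "\<And>S. S \<subseteq> {..<p} \<Longrightarrow> T - S \<noteq> {} \<Longrightarrow> card (S - T) \<le> 2 * card (T - S) \<Longrightarrow>
        c * \<sigma>\<^sup>2 * (real (card (T - S)) * N) \<le> RSS X (vec n mean_response) S"
    and over: "\<And>B. B \<subseteq> {..<p} - T \<Longrightarrow> B \<noteq> {} \<Longrightarrow> x \<notin> overfit_event L B"
    and lin: "\<And>S. S \<subseteq> {..<p} \<Longrightarrow> T - S \<noteq> {} \<Longrightarrow>
        x \<notin> linear_event (real (card (S - T)) * L / 8 + k * (real (card (T - S)) * N)) S"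
    and S: "S \<subseteq> {..<p}" "S \<noteq> T"
  shows "DCIC lam \<sigma> X (Y x) T < DCIC lam \<sigma> X (Y x) S"
proof -
  define a where "a = real (card (T - S))"
  define b where "b = real (card (S - T))"
  define q where "q = (RSS X (Y x) T - RSS X (Y x) (T \<union> (S - T))) / \<sigma>\<^sup>2"
  have finT: "finite T" using T_subset finite_subset by blast
  have finS: "finite S" using S finite_subset by blast
  have lnp: "ln (real p) \<ge> 0" using p_pos by simp
  have lnn: "ln (real n) > 0" using n by simp
  have N: "N > 0" using lnp lnn by (simp add: N_def)
  have L: "L > 0" using lnp lnn lam by (simp add: L_def add_pos_nonneg)
  \<comment> \<open>Uses lam \<ge> 1: the penalty scale L becomes comparable with the signal scale
    N.\<close>
  have "ln (real n) \<le> lam * ln (real n)" using lam lnn by simp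
  then have LN: "L \<le> lam * N" by (simp add: L_def N_def distrib_left)
  have q_le: "q \<le> b * L / 4"
  proof (cases "S - T = {}")
    case True
    show ?thesis unfolding q_def b_def True by simp
  next
    case False
    have "S - T \<subseteq> {..<p} - T" using S by auto
    from over[OF this False] show ?thesis using x by (simp add: overfit_event_def q_def b_def)
  qed
  have "card S + card (T - S) = card T + card (S - T)"
    using finS finT card_Diff_subset_Int[of S T] card_Diff_subset_Int[of T S]
    by (metis (no_types, lifting) card_Un_disjoint Diff_disjoint Un_Diff_cancel Un_commute finite_Diff)
  then have card: "real (card S) - real (card T) = b - a"
    unfolding a_def b_def by linarith
  define R where "R = (RSS X (Y x) S - RSS X (Y x) T) / \<sigma>\<^sup>2"
  have diff: "DCIC lam \<sigma> X (Y x) S - DCIC lam \<sigma> X (Y x) T = R + (b - a) * L"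
    using X_dim unfolding card[symmetric] R_def DCIC_def L_def by (simp add: algebra_simps diff_divide_distrib)
  show ?thesis
  proof (cases "b > 2 * a")
    case True
    \<comment> \<open>Enlarging S to its union with T only helps the competitor; its gain b L / 4
      still falls short of the net penalty, which exceeds b L / 2.\<close>
    have "RSS X (Y x) (T \<union> (S - T)) \<le> RSS X (Y x) S"
      unfolding response_eq using S T_subset by (intro RSS_antimono[OF X_dim]) auto
    then have "(RSS X (Y x) (T \<union> (S - T)) - RSS X (Y x) T) / \<sigma>\<^sup>2 \<le> R"
      unfolding R_def by (intro divide_right_mono) auto
    then have "- q \<le> R"
      by (simp add: q_def diff_divide_distrib)
    moreover have "b / 2 * L < (b - a) * L" using True L by (intro mult_strict_right_mono) auto
    moreover have "0 \<le> b * L" using L by (simp add: b_def)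
    ultimately show ?thesis using diff q_le by simp
  next
    case False
    have ne: "T - S \<noteq> {}"
    proof
      assume "T - S = {}"
      then have "T \<subseteq> S" by (simp only: Diff_eq_empty_iff)
      then have "\<not> S \<subseteq> T" using S(2) by (metis subset_antisym)
      then have "S - T \<noteq> {}" by (simp only: Diff_eq_empty_iff not_False_eq_True)
      have "a = 0" using \<open>T - S = {}\<close> by (simp only: a_def card.empty of_nat_0)
      have "b > 0" using finS \<open>S - T \<noteq> {}\<close> by (simp add: b_def card_gt_0_iff)
      then show False using False \<open>a = 0\<close> by simp
    qed
    then have a: "a > 0" using finT by (simp add: a_def card_gt_0_iff)
    define s where "s = RSS X (vec n mean_response) S"
    define h where "h = \<sigma> * ip n (resv X S mean_response) (\<lambda>i. std_error i x)"
    define \<tau> where "\<tau> = \<sigma>\<^sup>2 * (b * L / 8 + k * (a * N))"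
    have s: "c * \<sigma>\<^sup>2 * (a * N) \<le> s"
      unfolding s_def a_def by (rule signal[OF S(1) ne]) (use False in \<open>simp add: a_def b_def\<close>)
    have "(ip n (resv X S mean_response) (\<lambda>i. std_error i x))\<^sup>2 \<le> s * (b * L / 8 + k * (a * N))"
      using lin[OF S(1) ne] x by (simp add: linear_event_def s_def a_def b_def not_less)
    then have "\<sigma>\<^sup>2 * (ip n (resv X S mean_response) (\<lambda>i. std_error i x))\<^sup>2 \<le> \<sigma>\<^sup>2 * (s * (b * L / 8 + k * (a * N)))"
      by (intro mult_left_mono) auto
    then have h2: "h\<^sup>2 \<le> s * \<tau>" by (simp add: h_def \<tau>_def power_mult_distrib mult_ac)
    have "s \<ge> 0" unfolding s_def using ip_self_nonneg by (simp flip: ip_resv_self[OF X_dim S(1)])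
    have "b * L \<ge> 0" using L by (simp add: b_def)
    then have "\<tau> \<ge> 0" using k a N by (simp add: \<tau>_def)
    \<comment> \<open>Twice the geometric mean of s and \<tau> is at most s / 2 + 2 \<tau>: the
      cross term consumes half of the signal.\<close>
    have h: "- 2 * h \<le> s / 2 + 2 * \<tau>"
    proof -
      have "(2 * h)\<^sup>2 \<le> (s / 2 + 2 * \<tau>)\<^sup>2"
        using h2 sum_squares_ge_zero[of "s / 2 - 2 * \<tau>" 0] by (simp add: power2_eq_square algebra_simps)
      then have "\<bar>2 * h\<bar> \<le> \<bar>s / 2 + 2 * \<tau>\<bar>" by (simp only: abs_le_square_iff)
      then show ?thesis using \<open>s \<ge> 0\<close> \<open>\<tau> \<ge> 0\<close> by linarith
    qed
    have gap: "s / 2 - 2 * \<tau> - \<sigma>\<^sup>2 * q \<le> RSS X (Y x) S - RSS X (Y x) T"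
    proof -
      define e where "e = (\<lambda>i. \<sigma> * std_error i x)"
      have "RSS X (Y x) S = s + 2 * h + RSS X (vec n e) S"
        unfolding response_eq e_def s_def h_def RSS_add[OF X_dim S(1)] by (simp add: ip_scale_right)
      \<comment> \<open>S and T are not nested, so the noise parts are compared through their union,
        where the mean is fully explained.\<close>
      moreover have "RSS X (vec n e) (T \<union> S) \<le> RSS X (vec n e) S"
        using S T_subset by (intro RSS_antimono[OF X_dim]) auto
      moreover have "RSS X (Y x) T = RSS X (vec n e) T" "RSS X (Y x) (T \<union> S) = RSS X (vec n e) (T \<union> S)"
        using RSS_response_overfit[of T x] RSS_response_overfit[of "T \<union> S" x] T_subset S(1)
        by (auto simp: e_def)
      moreover have "\<sigma>\<^sup>2 * q = RSS X (Y x) T - RSS X (Y x) (T \<union> S)"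
        using sigma_pos by (simp add: q_def)
      ultimately show ?thesis using h by linarith
    qed
    have "\<sigma>\<^sup>2 * (c / 2 * (a * N) - 2 * (b * L / 8 + k * (a * N)) - b * L / 4) \<le> RSS X (Y x) S - RSS X (Y x) T"
    proof -
      have "\<sigma>\<^sup>2 * q \<le> \<sigma>\<^sup>2 * (b * L / 4)" using q_le by (intro mult_left_mono) auto
      then show ?thesis using gap s by (simp add: \<tau>_def algebra_simps)
    qed
    then have "c / 2 * (a * N) - 2 * (b * L / 8 + k * (a * N)) - b * L / 4 \<le> R"
      using sigma_pos unfolding R_def by (simp add: pos_le_divide_eq mult.commute)
    moreover have "a * L \<le> a * (lam * N)" using LN a by (intro mult_left_mono) auto
    moreover have "(2 * k + lam) * (a * N) < c / 2 * (a * N)"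
      using c a N by (intro mult_strict_right_mono) auto
    moreover have "0 \<le> b * L" using L by (simp add: b_def)
    ultimately show ?thesis using diff by (simp add: algebra_simps)
  qed
qed

text \<open>Union bound over the noise events; the parameter k of \<open>selects_truth\<close> is 8
  K, which produces the 16 K in the condition on \<open>c\<close>.\<close>

lemma selection_prob_ge:
  fixes lam c :: real
  defines "K \<equiv> mgf_const \<zeta>"
  assumes "\<zeta> > 0" and n: "n \<ge> 2" and lam: "lam \<ge> 1" "lam \<ge> 64 * K" and c: "c > 2 * (16 * K + lam)"
    and signal: "\<And>S. S \<subseteq> {..<p} \<Longrightarrow> T - S \<noteq> {} \<Longrightarrow> card (S - T) \<le> 2 * card (T - S) \<Longrightarrow>
        c * \<sigma>\<^sup>2 * (real (card (T - S)) * (ln (real p) + ln (real n))) \<le> missed_signal X (\<lambda>j. \<beta> $ j) S"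
  shows "selection_prob M X \<beta> \<sigma> \<epsilon> lam \<ge> 1 - failure_bound (1 / (8 * K)) n"
proof -
  have K: "K > 0" using mgf_const_pos[OF \<open>\<zeta> > 0\<close>] by (simp add: K_def)
  define N where "N = ln (real p) + ln (real n)"
  define L where "L = ln (real n) + lam * ln (real p)"
  have lnp: "ln (real p) \<ge> 0" using p_pos by simp
  have lnn: "ln (real n) > 0" using n by simp
  have N: "N > 0" using lnp lnn by (simp add: N_def)
  have L: "L > 0" using lnp lnn lam by (simp add: L_def add_pos_nonneg)
  have finT: "finite T" using T_subset finite_subset by blast
  have cT: "card T \<le> p" using card_mono[OF _ T_subset] by simp
  define D where "D = {..<p} - T"
  have finD: "finite D" and cD: "card D \<le> p"
    using card_mono[of "{..<p}" D] by (auto simp: D_def)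
  define I1 where "I1 = Pow D - {{}}"
  \<comment> \<open>A model S is encoded by the pair (T - S, S - T). The first component is nonempty
    because cross terms arise only for models that miss a signal.\<close>
  define I2 where "I2 = (Pow T - {{}}) \<times> Pow D"
  have fin: "finite I1" "finite I2" using finT finD by (auto simp: I1_def I2_def)
  \<comment> \<open>The share 8 K N per missed predictor yields the factor exp (- N) = 1 / (p n);
    the share L / 8 per added predictor pays for the number of choices of B.\<close>
  define t where "t AB = real (card (snd AB)) * L / 8 + 8 * K * (real (card (fst AB)) * N)" for AB :: "nat set \<times> nat set"
  define E2 where "E2 AB = linear_event (t AB) ((T - fst AB) \<union> snd AB)" for AB
  define bad where "bad = (\<Union>B\<in>I1. overfit_event L B) \<union> (\<Union>AB\<in>I2. E2 AB)"
  have m1: "overfit_event L B \<in> events" if "B \<in> I1" for B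
    using that by (intro overfit_event_measurable) (auto simp: I1_def D_def)
  have m2: "E2 AB \<in> events" for AB unfolding E2_def by (rule linear_event_measurable)
  have bad: "bad \<in> events" unfolding bad_def using fin m1 m2 by (intro sets.Un sets.finite_UN)
  define r where "r = exp (- (1 / (8 * K) / 8 * ln (real n)))"
  have p_exp: "real p = exp (ln (real p))" using p_pos by simp
  define y where "y = 2 * exp (- (L / 4 / (8 * K)))"
  define y2 where "y2 = exp (- (L / 8 / (8 * K)))"
  define x where "x = exp (- N)"
  \<comment> \<open>In L / (64 K) the summand lam ln p / (64 K) cancels the factor p, since lam
    \<ge> 64 K; the summand ln n / (64 K) is what remains as r.\<close>
  have y2: "p * y2 \<le> r"
  proof -
    have "64 * K * ln (real p) \<le> lam * ln (real p)" using lam lnp by (intro mult_right_mono) auto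
    then have "ln (real p) \<le> lam * ln (real p) / (64 * K)" using K by (simp add: field_simps)
    then have "ln (real p) + - (L / 8 / (8 * K)) \<le> - (1 / (8 * K) / 8 * ln (real n))"
      by (simp add: L_def add_divide_distrib)
    then have "exp (ln (real p)) * y2 \<le> r" unfolding y2_def r_def exp_add[symmetric] by simp
    then show ?thesis using p_exp by simp
  qed
  have y: "p * y \<le> 2 * r"
  proof -
    have "L / 8 / (8 * K) \<le> L / 4 / (8 * K)" using L K by (intro divide_right_mono) auto
    then have "y \<le> 2 * y2" by (simp add: y_def y2_def)
    then have "p * y \<le> p * (2 * y2)" by (intro mult_left_mono) auto
    then show ?thesis using y2 by simp
  qed
  have x: "p * x = 1 / n"
  proof -
    have "exp (ln (real p)) * x = exp (- ln (real n))" unfolding x_def exp_add[symmetric] by (simp add: N_def)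
    then show ?thesis using n p_exp by (simp add: exp_minus divide_inverse)
  qed
  have "prob (\<Union>B\<in>I1. overfit_event L B) \<le> (\<Sum>B\<in>I1. prob (overfit_event L B))"
    using m1 fin by (intro finite_measure_subadditive_finite) auto
  also have "\<dots> \<le> (\<Sum>B\<in>I1. y ^ card B)"
    unfolding y_def K_def
    by (intro sum_mono overfit_event_prob) (use \<open>\<zeta> > 0\<close> in \<open>auto simp: I1_def D_def\<close>)
  also have "\<dots> \<le> exp (p * y) - 1"
    unfolding I1_def using finD cD by (intro sum_power_card_nonempty_le) (auto simp: y_def)
  also have "\<dots> \<le> exp (2 * r) - 1" using y by simp
  finally have P1: "prob (\<Union>B\<in>I1. overfit_event L B) \<le> exp (2 * r) - 1" .
  have "prob (\<Union>AB\<in>I2. E2 AB) \<le> (\<Sum>AB\<in>I2. prob (E2 AB))"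
    using m2 fin by (intro finite_measure_subadditive_finite) auto
  also have "\<dots> \<le> (\<Sum>AB\<in>I2. 2 * (x ^ card (fst AB) * y2 ^ card (snd AB)))"
  proof (rule sum_mono)
    fix AB assume AB: "AB \<in> I2"
    have "prob (E2 AB) \<le> 2 * exp (- (t AB / (8 * K)))"
      unfolding E2_def K_def using AB T_subset L N K \<open>\<zeta> > 0\<close>
      by (intro linear_event_prob) (auto simp: I2_def D_def t_def)
    also have "t AB / (8 * K) = real (card (snd AB)) * (L / 8 / (8 * K)) + real (card (fst AB)) * N"
      using K by (simp add: t_def add_divide_distrib)
    also have "2 * exp (- \<dots>) = 2 * (x ^ card (fst AB) * y2 ^ card (snd AB))"
      by (simp add: x_def y2_def exp_of_nat_mult[symmetric] exp_add[symmetric])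
    finally show "prob (E2 AB) \<le> 2 * (x ^ card (fst AB) * y2 ^ card (snd AB))" .
  qed
  also have "\<dots> = 2 * ((\<Sum>A\<in>Pow T - {{}}. x ^ card A) * (\<Sum>B\<in>Pow D. y2 ^ card B))"
    unfolding I2_def sum_distrib_left[symmetric] by (subst sum_product) (simp only: sum.cartesian_product case_prod_unfold)
  also have "\<dots> \<le> 2 * ((exp (p * x) - 1) * exp (p * y2))"
    using finT finD cT cD
    by (intro mult_left_mono mult_mono sum_power_card_nonempty_le sum_power_card_Pow_le sum_nonneg)
       (auto simp: x_def y2_def)
  also have "\<dots> \<le> 2 * ((exp (1 / n) - 1) * exp r)"
    unfolding x using y2 by (intro mult_left_mono) auto
  finally have P2: "prob (\<Union>AB\<in>I2. E2 AB) \<le> 2 * ((exp (1 / n) - 1) * exp r)" .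
  have "prob bad \<le> prob (\<Union>B\<in>I1. overfit_event L B) + prob (\<Union>AB\<in>I2. E2 AB)"
    unfolding bad_def using fin m1 m2 by (intro measure_Un_le sets.finite_UN)
  also have "\<dots> \<le> failure_bound (1 / (8 * K)) n"
    using P1 P2 unfolding failure_bound_def r_def mult.assoc by linarith
  finally have P: "prob bad \<le> failure_bound (1 / (8 * K)) n" .
  have "space M - bad \<subseteq> {x \<in> space M. \<forall>S\<in>Pow {..<p} - {T}. DCIC lam \<sigma> X (Y x) T < DCIC lam \<sigma> X (Y x) S}"
  proof (intro subsetI CollectI conjI ballI)
    fix \<omega> S assume \<omega>: "\<omega> \<in> space M - bad" and S: "S \<in> Pow {..<p} - {T}"
    show "DCIC lam \<sigma> X (Y \<omega>) T < DCIC lam \<sigma> X (Y \<omega>) S"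
    proof (rule selects_truth[where k = "8 * K" and c = c])
      show "\<omega> \<notin> overfit_event (ln (real n) + lam * ln (real p)) B" if "B \<subseteq> {..<p} - T" "B \<noteq> {}" for B
        using \<omega> that by (auto simp: bad_def I1_def D_def L_def)
      show "\<omega> \<notin> linear_event (real (card (S - T)) * (ln (real n) + lam * ln (real p)) / 8
          + 8 * K * (real (card (T - S)) * (ln (real p) + ln (real n)))) S"
        if "S \<subseteq> {..<p}" "T - S \<noteq> {}" for S
      proof -
        have "(T - S, S - T) \<in> I2" using that by (auto simp: I2_def D_def)
        then have "\<omega> \<notin> E2 (T - S, S - T)" using \<omega> by (auto simp: bad_def)
        moreover have "T - (T - S) \<union> (S - T) = S" by auto
        ultimately show ?thesis by (simp add: E2_def t_def L_def N_def)
      qed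
    qed (use n lam c K S \<omega> signal in \<open>auto simp: missed_signal_mean_response\<close>)
  qed auto
  then have "prob (space M - bad) \<le> selection_prob M X \<beta> \<sigma> \<epsilon> lam"
    unfolding selection_prob_eq by (intro finite_measure_mono selection_set_measurable)
  then show ?thesis using P prob_compl[OF bad] by linarith
qed

end

section \<open>From curvature bounds to selection consistency\<close>

lemma sum_supp_ge:
  assumes "A \<subseteq> supp_vec \<beta>" "0 \<le> \<kappa>" "b \<le> (beta_min \<beta>)\<^sup>2" 
    and "\<kappa> * (\<Sum>j\<in>A. (\<beta> $ j)\<^sup>2) \<le> s"
  shows "\<kappa> * b * real (card A) \<le> s"
proof -
  have "real (card A) * b \<le> (\<Sum>j\<in>A. (\<beta> $ j)\<^sup>2)"
    using assms(1,3) beta_min_le by (intro sum_bounded_below) (meson order.trans subsetD)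
  then have "\<kappa> * (real (card A) * b) \<le> \<kappa> * (\<Sum>j\<in>A. (\<beta> $ j)\<^sup>2)"
    using assms(2) by (rule mult_left_mono)
  then show ?thesis using assms(4) by (simp add: mult_ac)
qed

text \<open>The common interface of the scenarios: \<open>\<kappa>\<close> will be 1 - \<omega>,
  \<epsilon>0 lam_star or 1 - \<omega>^2, and it cancels against the signal strength
  condition.\<close>

lemma (in subgaussian_linear_model) selection_prob_ge_of_curvature:
  fixes lam c \<kappa> :: real
  defines "K \<equiv> mgf_const \<zeta>"
  assumes "\<zeta> > 0" and n: "n \<ge> 2" and lam: "lam \<ge> 1" "lam \<ge> 64 * K" and c: "c > 2 * (16 * K + lam)"
    and \<kappa>: "\<kappa> > 0" and bm: "(beta_min \<beta>)\<^sup>2 \<ge> c * \<sigma>\<^sup>2 * ((ln (real p) + ln (real n)) / (\<kappa> * real n))"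
    and curvature: "\<And>S. S \<subseteq> {..<p} \<Longrightarrow> T - S \<noteq> {} \<Longrightarrow> card (S - T) \<le> 2 * card (T - S) \<Longrightarrow>
        n * \<kappa> * (\<Sum>j\<in>T - S. (\<beta> $ j)\<^sup>2) \<le> missed_signal X (\<lambda>j. \<beta> $ j) S"
  shows "selection_prob M X \<beta> \<sigma> \<epsilon> lam \<ge> 1 - failure_bound (1 / (8 * K)) n"
  unfolding K_def
proof (rule selection_prob_ge)
  fix S assume S: "S \<subseteq> {..<p}" "T - S \<noteq> {}" "card (S - T) \<le> 2 * card (T - S)"
  have "n * \<kappa> * (c * \<sigma>\<^sup>2 * ((ln (real p) + ln (real n)) / (\<kappa> * real n))) * real (card (T - S))
      \<le> missed_signal X (\<lambda>j. \<beta> $ j) S"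
    using curvature[OF S] \<kappa> bm by (intro sum_supp_ge[of _ \<beta>]) auto
  also have "n * \<kappa> * (c * \<sigma>\<^sup>2 * ((ln (real p) + ln (real n)) / (\<kappa> * real n))) * real (card (T - S))
      = c * \<sigma>\<^sup>2 * (real (card (T - S)) * (ln (real p) + ln (real n)))"
    using n \<kappa> by simp
  finally show "c * \<sigma>\<^sup>2 * (real (card (T - S)) * (ln (real p) + ln (real n))) \<le> missed_signal X (\<lambda>j. \<beta> $ j) S" .
qed (use assms in auto)

text \<open>Translates the cutoff on added versus missed predictors into the model size limit of
  Scenario 2.\<close>

lemma card_le_of_swap:
  assumes "finite S" "finite T" "card (S - T) \<le> 2 * card (T - S)"
  shows "card S \<le> 2 * card T"
proof -
  have "card S = card (S \<inter> T) + card (S - T)" using assms(1) by (metis card_Int_Diff)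
  moreover have "card T = card (S \<inter> T) + card (T - S)" using assms(2) by (metis Int_commute card_Int_Diff)
  ultimately show ?thesis using assms(3) by simp
qed

text \<open>The failure bound depends only on \<open>\<zeta>\<close> and n, so the probability
  space, p, the design and the noise level may all vary with n.\<close>

lemma selection_consistent:
  fixes M :: "nat \<Rightarrow> 'a measure" and p :: "nat \<Rightarrow> nat" and \<kappa> :: "nat \<Rightarrow> real"
  assumes "\<zeta> > 0" and lam: "lam \<ge> max 1 (64 * mgf_const \<zeta>)" and c: "c > 2 * (16 * mgf_const \<zeta> + lam)"
    and model: "\<forall>\<^sub>F n in sequentially.
       subgaussian_linear_model (M n) n (p n) (X n) (\<beta> n) (\<sigma> n) \<zeta> (\<epsilon> n)"
    and cond: "\<forall>\<^sub>F n in sequentially. \<kappa> n > 0 \<and>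
       (beta_min (\<beta> n))\<^sup>2 \<ge> c * (\<sigma> n)\<^sup>2 * ((ln (real (p n)) + ln (real n)) / (\<kappa> n * real n)) \<and>
       (\<forall>S. S \<subseteq> {..<p n} \<longrightarrow> supp_vec (\<beta> n) - S \<noteq> {} \<longrightarrow>
          card (S - supp_vec (\<beta> n)) \<le> 2 * card (supp_vec (\<beta> n) - S) \<longrightarrow>
          n * \<kappa> n * (\<Sum>j\<in>supp_vec (\<beta> n) - S. (\<beta> n $ j)\<^sup>2) \<le> missed_signal (X n) (\<lambda>j. \<beta> n $ j) S)"
  shows "(\<lambda>n. selection_prob (M n) (X n) (\<beta> n) (\<sigma> n) (\<epsilon> n) lam) \<longlonglongrightarrow> 1"
proof (rule tendsto_sandwich)
  define \<theta> where "\<theta> = 1 / (8 * mgf_const \<zeta>)"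
  show "\<forall>\<^sub>F n in sequentially. 1 - failure_bound \<theta> n
      \<le> selection_prob (M n) (X n) (\<beta> n) (\<sigma> n) (\<epsilon> n) lam"
    using model cond eventually_ge_at_top[of 2]
  proof eventually_elim
    case (elim n)
    interpret subgaussian_linear_model "M n" n "p n" "X n" "\<beta> n" "\<sigma> n" \<zeta> "\<epsilon> n" by (rule elim(1))
    show ?case unfolding \<theta>_def
      by (rule selection_prob_ge_of_curvature[of lam c "\<kappa> n"]) (use elim assms(1) lam c in auto)
  qed
  show "\<forall>\<^sub>F n in sequentially. selection_prob (M n) (X n) (\<beta> n) (\<sigma> n) (\<epsilon> n) lam \<le> 1"
    using model
  proof eventually_elim
    case (elim n)
    interpret subgaussian_linear_model "M n" n "p n" "X n" "\<beta> n" "\<sigma> n" \<zeta> "\<epsilon> n" by (rule elim)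
    show ?case unfolding selection_prob_def by (rule prob_le_1)
  qed
  have "failure_bound \<theta> \<longlonglongrightarrow> 0"
    using mgf_const_pos[OF \<open>\<zeta> > 0\<close>] by (intro failure_bound_tendsto_0) (simp add: \<theta>_def)
  then show "(\<lambda>n. 1 - failure_bound \<theta> n) \<longlonglongrightarrow> 1"
    using tendsto_diff[OF tendsto_const, of "failure_bound \<theta>" 0 sequentially 1] by simp
qed simp

theorem theorem2p8:
  fixes \<zeta> :: real
  assumes "\<zeta> > 0"
  shows "\<exists>lam_sel :: real. \<forall>lam \<ge> lam_sel. \<exists>c > 0.
    \<forall>(M :: nat \<Rightarrow> 'a measure) (p :: nat \<Rightarrow> nat) (X :: nat \<Rightarrow> real mat) (\<beta> :: nat \<Rightarrow> real vec)
      (\<sigma> :: nat \<Rightarrow> real) (\<epsilon> :: nat \<Rightarrow> nat \<Rightarrow> 'a \<Rightarrow> real).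
    (\<forall>\<^sub>F n in sequentially.
       subgaussian_linear_model (M n) n (p n) (X n) (\<beta> n) (\<sigma> n) \<zeta> (\<epsilon> n)) \<longrightarrow>
    (\<forall>\<omega> :: nat \<Rightarrow> real.
       (\<forall>\<^sub>F n in sequentially. scenario1 (X n) (\<omega> n) \<and>
          (beta_min (\<beta> n))\<^sup>2 \<ge>
            c * (\<sigma> n)\<^sup>2 * ((ln (real (p n)) + ln (real n)) / ((1 - \<omega> n) * real n))) \<longrightarrow>
       (\<lambda>n. selection_prob (M n) (X n) (\<beta> n) (\<sigma> n) (\<epsilon> n) lam) \<longlonglongrightarrow> 1) \<and>
    (\<forall>(\<kappa>0 :: real) (\<epsilon>0 :: real) (lam_star :: nat \<Rightarrow> real). \<kappa>0 \<ge> 1 \<longrightarrow> 0 < \<epsilon>0 \<longrightarrow> \<epsilon>0 < 1 \<longrightarrow>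
       (\<forall>\<^sub>F n in sequentially. scenario2 (X n) (\<beta> n) (lam_star n) \<kappa>0 \<epsilon>0 \<and>
          (beta_min (\<beta> n))\<^sup>2 \<ge>
            c * (\<sigma> n)\<^sup>2 * ((ln (real (p n)) + ln (real n)) / (\<epsilon>0 * lam_star n * real n))) \<longrightarrow>
       (\<lambda>n. selection_prob (M n) (X n) (\<beta> n) (\<sigma> n) (\<epsilon> n) lam) \<longlonglongrightarrow> 1) \<and>
    (\<forall>\<omega> :: nat \<Rightarrow> real.
       (\<forall>\<^sub>F n in sequentially. scenario3 (X n) (supp_vec (\<beta> n)) (\<omega> n) \<and>
          (beta_min (\<beta> n))\<^sup>2 \<ge>
            c * (\<sigma> n)\<^sup>2 * ((ln (real (p n)) + ln (real n)) / ((1 - (\<omega> n)\<^sup>2) * real n))) \<longrightarrow>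
       (\<lambda>n. selection_prob (M n) (X n) (\<beta> n) (\<sigma> n) (\<epsilon> n) lam) \<longlonglongrightarrow> 1)"
\<comment> \<open>64 K balances the number of added sets; 1 makes L at most lam N. The witness for c
  stays open here.\<close>
proof (rule exI[of _ "max 1 (64 * mgf_const \<zeta>)"], rule allI, rule impI, rule exI, intro conjI allI impI)
  fix lam :: real assume lam: "max 1 (64 * mgf_const \<zeta>) \<le> lam"
  define c where "c = 2 * (16 * mgf_const \<zeta> + lam) + 1"
  have c: "c > 2 * (16 * mgf_const \<zeta> + lam)" by (simp add: c_def)
  \<comment> \<open>This goal fixes the witness for c, in terms of \<open>\<zeta>\<close> and lam
    alone; the final 1 makes the required inequality strict.\<close>
  show "0 < 2 * (16 * mgf_const \<zeta> + lam) + 1" using mgf_const_pos[OF assms] lam by simp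
  fix M :: "nat \<Rightarrow> 'a measure" and p :: "nat \<Rightarrow> nat" and X :: "nat \<Rightarrow> real mat"
    and \<beta> :: "nat \<Rightarrow> real vec" and \<sigma> :: "nat \<Rightarrow> real" and \<epsilon> :: "nat \<Rightarrow> nat \<Rightarrow> 'a \<Rightarrow> real"
  assume model: "\<forall>\<^sub>F n in sequentially.
       subgaussian_linear_model (M n) n (p n) (X n) (\<beta> n) (\<sigma> n) \<zeta> (\<epsilon> n)"
  have supp: "supp_vec b \<subseteq> {..<q}" if "b \<in> carrier_vec q" for b q
    using that by (auto simp: supp_vec_def)
  note consistent = selection_consistent[OF assms lam c model]
  {
    fix \<omega> :: "nat \<Rightarrow> real"
    assume *: "\<forall>\<^sub>F n in sequentially. scenario1 (X n) (\<omega> n) \<and>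
        (beta_min (\<beta> n))\<^sup>2 \<ge> (2 * (16 * mgf_const \<zeta> + lam) + 1) * (\<sigma> n)\<^sup>2
          * ((ln (real (p n)) + ln (real n)) / ((1 - \<omega> n) * real n))"
    show "(\<lambda>n. selection_prob (M n) (X n) (\<beta> n) (\<sigma> n) (\<epsilon> n) lam) \<longlonglongrightarrow> 1"
    proof (rule consistent[of "\<lambda>n. 1 - \<omega> n"])
      show "\<forall>\<^sub>F n in sequentially. 1 - \<omega> n > 0 \<and>
       (beta_min (\<beta> n))\<^sup>2 \<ge> c * (\<sigma> n)\<^sup>2 * ((ln (real (p n)) + ln (real n)) / ((1 - \<omega> n) * real n)) \<and>
       (\<forall>S. S \<subseteq> {..<p n} \<longrightarrow> supp_vec (\<beta> n) - S \<noteq> {} \<longrightarrow>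
          card (S - supp_vec (\<beta> n)) \<le> 2 * card (supp_vec (\<beta> n) - S) \<longrightarrow>
          n * (1 - \<omega> n) * (\<Sum>j\<in>supp_vec (\<beta> n) - S. (\<beta> n $ j)\<^sup>2) \<le> missed_signal (X n) (\<lambda>j. \<beta> n $ j) S)"
        using model * eventually_gt_at_top[of 0]
      proof eventually_elim
        case (elim n)
        interpret subgaussian_linear_model "M n" n "p n" "X n" "\<beta> n" "\<sigma> n" \<zeta> "\<epsilon> n" by (rule elim(1))
        have "1 - \<omega> n > 0" using elim by (simp add: scenario1_def)
        moreover have "n * (1 - \<omega> n) * (\<Sum>j\<in>T - S. (\<beta> n $ j)\<^sup>2) \<le> missed_signal (X n) (\<lambda>j. \<beta> n $ j) S"
          if "S \<subseteq> {..<p n}" for S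
          using elim T_subset by (intro scenario1_missed_signal[OF _ X_dim _ that]) auto
        ultimately show ?case using elim(2) unfolding c_def by blast
      qed
    qed
  next
    fix \<kappa>0 \<epsilon>0 :: real and lam_star :: "nat \<Rightarrow> real"
    assume \<epsilon>0: "1 \<le> \<kappa>0" "0 < \<epsilon>0"
      and *: "\<forall>\<^sub>F n in sequentially. scenario2 (X n) (\<beta> n) (lam_star n) \<kappa>0 \<epsilon>0 \<and>
        (beta_min (\<beta> n))\<^sup>2 \<ge> (2 * (16 * mgf_const \<zeta> + lam) + 1) * (\<sigma> n)\<^sup>2
          * ((ln (real (p n)) + ln (real n)) / (\<epsilon>0 * lam_star n * real n))"
    show "(\<lambda>n. selection_prob (M n) (X n) (\<beta> n) (\<sigma> n) (\<epsilon> n) lam) \<longlonglongrightarrow> 1"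
    proof (rule consistent[of "\<lambda>n. \<epsilon>0 * lam_star n"])
      show "\<forall>\<^sub>F n in sequentially. \<epsilon>0 * lam_star n > 0 \<and>
       (beta_min (\<beta> n))\<^sup>2 \<ge> c * (\<sigma> n)\<^sup>2 * ((ln (real (p n)) + ln (real n)) / (\<epsilon>0 * lam_star n * real n)) \<and>
       (\<forall>S. S \<subseteq> {..<p n} \<longrightarrow> supp_vec (\<beta> n) - S \<noteq> {} \<longrightarrow>
          card (S - supp_vec (\<beta> n)) \<le> 2 * card (supp_vec (\<beta> n) - S) \<longrightarrow>
          n * (\<epsilon>0 * lam_star n) * (\<Sum>j\<in>supp_vec (\<beta> n) - S. (\<beta> n $ j)\<^sup>2) \<le> missed_signal (X n) (\<lambda>j. \<beta> n $ j) S)"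
        using model * eventually_gt_at_top[of 0]
      proof eventually_elim
        case (elim n)
        interpret subgaussian_linear_model "M n" n "p n" "X n" "\<beta> n" "\<sigma> n" \<zeta> "\<epsilon> n" by (rule elim(1))
        have "\<epsilon>0 * lam_star n > 0" using elim \<epsilon>0 by (simp add: scenario2_def)
        moreover have "n * (\<epsilon>0 * lam_star n) * (\<Sum>j\<in>T - S. (\<beta> n $ j)\<^sup>2) \<le> missed_signal (X n) (\<lambda>j. \<beta> n $ j) S"
          if S: "S \<subseteq> {..<p n}" "T - S \<noteq> {}" "card (S - T) \<le> 2 * card (T - S)" for S
        proof (rule scenario2_missed_signal[OF _ X_dim _ beta_dim \<epsilon>0(2) S(1) _ S(2)])
          have "card S \<le> 2 * card T"
            by (rule card_le_of_swap[OF finite_subset[OF S(1) finite_lessThan]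
                  finite_subset[OF T_subset finite_lessThan] S(3)])
          then have "real (card S) \<le> 2 * real (card T)" by linarith
          \<comment> \<open>Here \<kappa>0 \<ge> 1 meets the factor 2 of the cutoff.\<close>
          also have "\<dots> \<le> (1 + \<kappa>0) * real (card T)" using \<epsilon>0 by (intro mult_right_mono) auto
          finally show "real (card S) \<le> (1 + \<kappa>0) * real (card T)" .
        qed (rule conjunct1[OF elim(2)], rule elim(3))
        ultimately show ?case using elim(2) unfolding c_def by blast
      qed
    qed
  next
    fix \<omega> :: "nat \<Rightarrow> real"
    assume *: "\<forall>\<^sub>F n in sequentially. scenario3 (X n) (supp_vec (\<beta> n)) (\<omega> n) \<and>
        (beta_min (\<beta> n))\<^sup>2 \<ge> (2 * (16 * mgf_const \<zeta> + lam) + 1) * (\<sigma> n)\<^sup>2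
          * ((ln (real (p n)) + ln (real n)) / ((1 - (\<omega> n)\<^sup>2) * real n))"
    show "(\<lambda>n. selection_prob (M n) (X n) (\<beta> n) (\<sigma> n) (\<epsilon> n) lam) \<longlonglongrightarrow> 1"
    proof (rule consistent[of "\<lambda>n. 1 - (\<omega> n)\<^sup>2"])
      show "\<forall>\<^sub>F n in sequentially. 1 - (\<omega> n)\<^sup>2 > 0 \<and>
       (beta_min (\<beta> n))\<^sup>2 \<ge> c * (\<sigma> n)\<^sup>2 * ((ln (real (p n)) + ln (real n)) / ((1 - (\<omega> n)\<^sup>2) * real n)) \<and>
       (\<forall>S. S \<subseteq> {..<p n} \<longrightarrow> supp_vec (\<beta> n) - S \<noteq> {} \<longrightarrow>
          card (S - supp_vec (\<beta> n)) \<le> 2 * card (supp_vec (\<beta> n) - S) \<longrightarrow>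
          n * (1 - (\<omega> n)\<^sup>2) * (\<Sum>j\<in>supp_vec (\<beta> n) - S. (\<beta> n $ j)\<^sup>2) \<le> missed_signal (X n) (\<lambda>j. \<beta> n $ j) S)"
        using model * eventually_gt_at_top[of 0]
      proof eventually_elim
        case (elim n)
        interpret subgaussian_linear_model "M n" n "p n" "X n" "\<beta> n" "\<sigma> n" \<zeta> "\<epsilon> n" by (rule elim(1))
        have "0 < \<omega> n" "\<omega> n < 1" using elim by (simp_all add: scenario3_def)
        then have "1 - (\<omega> n)\<^sup>2 > 0" by (simp add: power_less_one_iff)
        moreover have "n * (1 - (\<omega> n)\<^sup>2) * (\<Sum>j\<in>T - S. (\<beta> n $ j)\<^sup>2) \<le> missed_signal (X n) (\<lambda>j. \<beta> n $ j) S"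
          if "S \<subseteq> {..<p n}" for S
          using elim by (intro scenario3_missed_signal[OF _ X_dim _ T_subset that]) auto
        ultimately show ?case using elim(2) unfolding c_def by blast
      qed
    qed
  }
qed

end
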